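(* Let $N$ be a solvable normal subgroup of a finite group $G$. If $G/N$ satisfies the $(\mu,\lambda)$-property, then $G$ also satisfies the $(\mu,\lambda)$-property.
   Context: The Möbius function of a finite poset $P$ is the map $\mu_P:P\times P\to\mathbb Z$ with $\mu_P(x,y)=0$ unless $x\leq y$, $\mu_P(x,x)=1$, and $\sum_{x\leq z\leq y}\mu_P(x,z)=0$ for $x<y$. For a finite group $G$, $\mu$ denotes the Möbius function of the lattice of subgroups of $G$, and $\lambda$ denotes the Möbius function of the poset of $G$-conjugacy classes $[H]$ of subgroups $H\leq G$, ordered by $[H]\leq [K]$ if $H\leq K^g$ for some $g\in G$; write $\lambda(H,K)=\lambda([H],[K])$. A finite group $G$ satisfies the $(\mu,\lambda)$-property if, for every subgroup $H\leq G$, $$\mu(H,G)=|N_{G'}(H):G'\cap H|\cdot\lambda(H,G),$$ where $G'$ is the derived subgroup of $G$ and $N_{G'}(H)=N_G(H)\cap G'$. *)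

theory Defs
  imports "HOL-Algebra.Algebra"
begin

definition is_moebius :: "('a, 'b) gorder_scheme \<Rightarrow> ('a \<Rightarrow> 'a \<Rightarrow> int) \<Rightarrow> bool" where
  "is_moebius L m \<longleftrightarrow>
     (\<forall>x y. \<not> (x \<in> carrier L \<and> y \<in> carrier L \<and> x \<sqsubseteq>\<^bsub>L\<^esub> y) \<longrightarrow> m x y = 0) \<and>
     (\<forall>x \<in> carrier L. m x x = 1) \<and>
     (\<forall>x \<in> carrier L. \<forall>y \<in> carrier L. x \<sqsubseteq>\<^bsub>L\<^esub> y \<and> x \<noteq> y \<longrightarrow>
        (\<Sum>z \<in> {z \<in> carrier L. x \<sqsubseteq>\<^bsub>L\<^esub> z \<and> z \<sqsubseteq>\<^bsub>L\<^esub> y}. m x z) = 0)"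

text \<open>The description below is meaningful for finite partial orders, where existence and
  uniqueness hold by \<open>ex1_moebius\<close>.\<close>

definition moebius :: "('a, 'b) gorder_scheme \<Rightarrow> 'a \<Rightarrow> 'a \<Rightarrow> int" where
  "moebius L = (THE m. is_moebius L m)"

lemma ex1_moebius:
  fixes L (structure)
  assumes "partial_order L" and fin: "finite (carrier L)"
  shows "\<exists>!m. is_moebius L m"
proof -
  interpret partial_order L by fact
  define R where "R = {(z, y). z \<in> carrier L \<and> y \<in> carrier L \<and> z \<sqsubseteq> y \<and> z \<noteq> y}"
  define B where "B x y = {z \<in> carrier L. x \<sqsubseteq> z \<and> z \<sqsubseteq> y \<and> z \<noteq> y}" for x y
  have finB: "finite (B x y)" for x y
    using fin by (simp add: B_def)
  have split: "{z \<in> carrier L. x \<sqsubseteq> z \<and> z \<sqsubseteq> y} = insert y (B x y)"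
    if "y \<in> carrier L" "x \<sqsubseteq> y" for x y
    using that by (auto simp: B_def)
  have nB: "y \<notin> B x y" for x y
    by (simp add: B_def)
  have "wf R"
  proof (rule wf_subset[OF wf_measure[of "\<lambda>y. card {w \<in> carrier L. w \<sqsubseteq> y}"]], clarsimp simp: R_def)
    fix z y assume zy: "z \<in> carrier L" "y \<in> carrier L" "z \<sqsubseteq> y" "z \<noteq> y"
    have "{w \<in> carrier L. w \<sqsubseteq> z} \<subseteq> {w \<in> carrier L. w \<sqsubseteq> y}"
      using zy le_trans by blast
    moreover have "y \<notin> {w \<in> carrier L. w \<sqsubseteq> z}"
      using zy le_antisym by blast
    moreover have "y \<in> {w \<in> carrier L. w \<sqsubseteq> y}"
      using zy by simp
    ultimately show "card {w \<in> carrier L. w \<sqsubseteq> z} < card {w \<in> carrier L. w \<sqsubseteq> y}"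
      using fin by (intro psubset_card_mono) auto
  qed
  define F where "F x f y = (if \<not> (x \<in> carrier L \<and> y \<in> carrier L \<and> x \<sqsubseteq> y) then 0
      else if x = y then 1 else - (\<Sum>z \<in> B x y. f z))" for x y and f :: "_ \<Rightarrow> int"
  define m where "m x = wfrec R (F x)" for x
  have m: "m x y = F x (m x) y" for x y
  proof -
    have "m x y = F x (cut (m x) R y) y"
      unfolding m_def by (rule wfrec[OF \<open>wf R\<close>])
    also have "\<dots> = F x (m x) y"
      by (auto simp: F_def B_def R_def cut_apply intro!: sum.cong)
    finally show ?thesis .
  qed
  have "is_moebius L m"
    unfolding is_moebius_def
  proof (intro conjI allI ballI impI)
    fix x y assume xy: "x \<in> carrier L" "y \<in> carrier L" "x \<sqsubseteq> y \<and> x \<noteq> y"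
    then show "(\<Sum>z \<in> {z \<in> carrier L. x \<sqsubseteq> z \<and> z \<sqsubseteq> y}. m x z) = 0"
      using m[of x y] by (simp add: split finB nB F_def)
  qed (subst m, simp add: F_def)+
  moreover have "m' = m" if m': "is_moebius L m'" for m'
  proof (intro ext)
    fix x y
    show "m' x y = m x y"
      using \<open>wf R\<close>
    proof (induction y rule: wf_induct_rule)
      case (less y)
      show ?case
      proof (cases "x \<in> carrier L \<and> y \<in> carrier L \<and> x \<sqsubseteq> y \<and> x \<noteq> y")
        case True
        have "m' x y = - (\<Sum>z \<in> B x y. m' x z)"
        proof -
          have "(\<Sum>z \<in> {z \<in> carrier L. x \<sqsubseteq> z \<and> z \<sqsubseteq> y}. m' x z) = 0"
            using m' True unfolding is_moebius_def by blast
          then show ?thesis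
            using True by (simp add: split finB nB)
        qed
        also have "\<dots> = - (\<Sum>z \<in> B x y. m x z)"
          using less True by (auto simp: B_def R_def intro!: sum.cong)
        also have "\<dots> = m x y"
          using True by (simp add: m[of x y] F_def)
        finally show ?thesis .
      next
        case False
        then show ?thesis
          using m' \<open>is_moebius L m\<close> unfolding is_moebius_def by metis
      qed
    qed
  qed
  ultimately show ?thesis by blast
qed

corollary is_moebius_moebius:
  assumes "partial_order L" and "finite (carrier L)"
  shows "is_moebius L (moebius L)"
  unfolding moebius_def using ex1_moebius[OF assms] by (rule theI')

definition subgroup_lattice :: "('a, 'b) monoid_scheme \<Rightarrow> 'a set gorder" where
  "subgroup_lattice G = \<lparr>carrier = {H. subgroup H G}, eq = (=), le = (\<subseteq>)\<rparr>"

text \<open>The action is the one of \<open>group.action_by_conjugation_on_subgroups_set\<close>.\<close>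

definition subgroup_class :: "('a, 'b) monoid_scheme \<Rightarrow> 'a set \<Rightarrow> 'a set set" where
  "subgroup_class G H =
     orbit G (\<lambda>g. \<lambda>K \<in> {K. subgroup K G}. g <#\<^bsub>G\<^esub> K #>\<^bsub>G\<^esub> inv\<^bsub>G\<^esub> g) H"

definition subgroup_class_poset :: "('a, 'b) monoid_scheme \<Rightarrow> 'a set set gorder" where
  "subgroup_class_poset G =
     \<lparr>carrier = subgroup_class G ` {H. subgroup H G}, eq = (=),
      le = (\<lambda>C D. \<exists>H K. subgroup H G \<and> subgroup K G \<and>
              C = subgroup_class G H \<and> D = subgroup_class G K \<and>
              (\<exists>g \<in> carrier G. H \<subseteq> inv\<^bsub>G\<^esub> g <#\<^bsub>G\<^esub> K #>\<^bsub>G\<^esub> g))\<rparr>"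

definition moebius_subgroups :: "('a, 'b) monoid_scheme \<Rightarrow> 'a set \<Rightarrow> 'a set \<Rightarrow> int" where
  "moebius_subgroups G H K = moebius (subgroup_lattice G) H K"

definition moebius_classes :: "('a, 'b) monoid_scheme \<Rightarrow> 'a set \<Rightarrow> 'a set \<Rightarrow> int" where
  "moebius_classes G H K =
     moebius (subgroup_class_poset G) (subgroup_class G H) (subgroup_class G K)"

definition subgroup_index :: "('a, 'b) monoid_scheme \<Rightarrow> 'a set \<Rightarrow> 'a set \<Rightarrow> nat" where
  "subgroup_index G K H = card (rcosets\<^bsub>G\<lparr>carrier := K\<rparr>\<^esub> H)"

definition mu_lambda_property :: "('a, 'b) monoid_scheme \<Rightarrow> bool" where
  "mu_lambda_property G \<longleftrightarrow>
     (\<forall>H. subgroup H G \<longrightarrow>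
        moebius_subgroups G H (carrier G) =
          int (subgroup_index G (normalizer G H \<inter> derived G (carrier G))
                (derived G (carrier G) \<inter> H)) *
          moebius_classes G H (carrier G))"


text \<open>Both orders are finite partial orders, so \<open>is_moebius_moebius\<close> applies to them.\<close>

lemma (in group) partial_order_subgroup_lattice: "partial_order (subgroup_lattice G)"
  unfolding subgroup_lattice_def by unfold_locales auto

lemma (in group) finite_subgroups:
  assumes "finite (carrier G)"
  shows "finite {H. subgroup H G}"
  by (rule finite_subset[of _ "Pow (carrier G)"]) (auto simp: assms dest: subgroup.subset)

lemma (in group) subgroup_class_eq:
  assumes "subgroup H G"
  shows "subgroup_class G H = (\<lambda>g. g <# H #> inv g) ` carrier G"
  using assms by (auto simp: subgroup_class_def orbit_def)

lemma (in group) conj_subset_iff: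
  assumes "g \<in> carrier G" "H \<subseteq> carrier G" "K \<subseteq> carrier G"
  shows "H \<subseteq> inv g <# K #> g \<longleftrightarrow> g <# H #> inv g \<subseteq> K"
proof
  assume *: "H \<subseteq> inv g <# K #> g"
  show "g <# H #> inv g \<subseteq> K"
  proof
    fix x assume "x \<in> g <# H #> inv g"
    then obtain h where h: "h \<in> H" "x = g \<otimes> h \<otimes> inv g"
      by (auto simp: l_coset_def r_coset_def)
    then obtain k where k: "k \<in> K" "h = inv g \<otimes> k \<otimes> g"
      using * by (auto simp: l_coset_def r_coset_def)
    have "k \<in> carrier G" using k assms by blast
    then have "x = k"
      using assms by (simp add: h k m_assoc inv_solve_left' flip: m_assoc[of g "inv g"])
    then show "x \<in> K" using k by simp
  qed
next
  assume *: "g <# H #> inv g \<subseteq> K"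
  show "H \<subseteq> inv g <# K #> g"
  proof
    fix h assume h: "h \<in> H"
    then have hc: "h \<in> carrier G" using assms by blast
    have "g \<otimes> h \<otimes> inv g \<in> K"
      using h * by (auto simp: l_coset_def r_coset_def)
    moreover have "h = inv g \<otimes> (g \<otimes> h \<otimes> inv g) \<otimes> g"
      using assms hc by (simp add: m_assoc inv_solve_left)
    ultimately show "h \<in> inv g <# K #> g"
      by (auto simp: l_coset_def r_coset_def)
  qed
qed

lemma (in group) conj_conj:
  assumes "g \<in> carrier G" "h \<in> carrier G" "H \<subseteq> carrier G"
  shows "h <# (g <# H #> inv g) #> inv h = (h \<otimes> g) <# H #> inv (h \<otimes> g)"
  using assms
  by (simp add: coset_assoc[symmetric] coset_mult_assoc lcos_m_assoc l_coset_subset_G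
        r_coset_subset_G inv_mult_group)

lemma (in group) conj_one:
  assumes "H \<subseteq> carrier G"
  shows "\<one> <# H #> inv \<one> = H"
  using assms by (simp add: lcos_mult_one)

lemma (in group) subgroup_class_eq_iff:
  assumes H: "subgroup H G" and K: "subgroup K G"
  shows "subgroup_class G H = subgroup_class G K \<longleftrightarrow> (\<exists>g \<in> carrier G. K = g <# H #> inv g)"
proof
  assume eq: "subgroup_class G H = subgroup_class G K"
  have "K \<in> subgroup_class G K"
    using conj_one[OF subgroup.subset[OF K]] by (force simp: subgroup_class_eq[OF K])
  then show "\<exists>g \<in> carrier G. K = g <# H #> inv g"
    by (auto simp: eq[symmetric] subgroup_class_eq[OF H])
next
  assume "\<exists>g \<in> carrier G. K = g <# H #> inv g"
  then obtain g where g: "g \<in> carrier G" "K = g <# H #> inv g" by blast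
  note Hs = subgroup.subset[OF H]
  have "h <# H #> inv h = (h \<otimes> inv g) <# K #> inv (h \<otimes> inv g)" if "h \<in> carrier G" for h
    using g that by (simp add: conj_conj Hs m_assoc)
  moreover have "h <# K #> inv h = (h \<otimes> g) <# H #> inv (h \<otimes> g)" if "h \<in> carrier G" for h
    using g that by (simp add: conj_conj Hs)
  ultimately show "subgroup_class G H = subgroup_class G K"
    unfolding subgroup_class_eq[OF H] subgroup_class_eq[OF K]
    using g(1) by (auto simp: image_iff) (metis m_closed inv_closed)+
qed

lemma (in group) subgroup_class_le_iff:
  assumes H: "subgroup H G" and K: "subgroup K G"
  shows "subgroup_class G H \<sqsubseteq>\<^bsub>subgroup_class_poset G\<^esub> subgroup_class G K \<longleftrightarrow>
    (\<exists>g \<in> carrier G. H \<subseteq> inv g <# K #> g)"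
proof
  assume "subgroup_class G H \<sqsubseteq>\<^bsub>subgroup_class_poset G\<^esub> subgroup_class G K"
  then obtain H' K' g where *: "subgroup H' G" "subgroup K' G"
    "subgroup_class G H' = subgroup_class G H" "subgroup_class G K' = subgroup_class G K"
    "g \<in> carrier G" "H' \<subseteq> inv g <# K' #> g"
    by (auto simp: subgroup_class_poset_def)
  obtain a where a: "a \<in> carrier G" "H' = a <# H #> inv a"
    using *(3) subgroup_class_eq_iff[of H H'] * H by auto
  obtain b where b: "b \<in> carrier G" "K = b <# K' #> inv b"
    using *(4) subgroup_class_eq_iff[of K' K] * K by auto
  note S = subgroup.subset[OF H] subgroup.subset[OF K] subgroup.subset[OF *(1)] subgroup.subset[OF *(2)]
  have "g <# H' #> inv g \<subseteq> K'"
    using * S conj_subset_iff by blast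
  then have "b <# (g <# H' #> inv g) #> inv b \<subseteq> K"
    unfolding b(2) by (auto simp: l_coset_def r_coset_def)
  then have "(b \<otimes> g \<otimes> a) <# H #> inv (b \<otimes> g \<otimes> a) \<subseteq> K"
    using a b(1) *(5) S by (simp add: conj_conj m_assoc)
  then have "H \<subseteq> inv (b \<otimes> g \<otimes> a) <# K #> (b \<otimes> g \<otimes> a)"
    using a b(1) *(5) S by (subst conj_subset_iff) auto
  then show "\<exists>g \<in> carrier G. H \<subseteq> inv g <# K #> g"
    using a b(1) *(5) by blast
next
  assume "\<exists>g \<in> carrier G. H \<subseteq> inv g <# K #> g"
  then show "subgroup_class G H \<sqsubseteq>\<^bsub>subgroup_class_poset G\<^esub> subgroup_class G K"
    using H K by (auto simp: subgroup_class_poset_def)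
qed

lemma (in group) partial_order_subgroup_class_poset:
  assumes fin: "finite (carrier G)"
  shows "partial_order (subgroup_class_poset G)"
proof -
  let ?P = "subgroup_class_poset G"
  have carr: "carrier ?P = subgroup_class G ` {H. subgroup H G}" and eq: "eq ?P = (=)"
    by (simp_all add: subgroup_class_poset_def)
  have le: "subgroup_class G H \<sqsubseteq>\<^bsub>?P\<^esub> subgroup_class G K \<longleftrightarrow>
      (\<exists>g \<in> carrier G. g <# H #> inv g \<subseteq> K)" if "subgroup H G" "subgroup K G" for H K
    using that by (auto simp: subgroup_class_le_iff conj_subset_iff subgroup.subset)
  have card_conj: "card (g <# H #> inv g) = card H" if "g \<in> carrier G" "subgroup H G" for g H
  proof -
    have s: "H \<subseteq> carrier G" by (rule subgroup.subset) fact
    have "g <# H #> inv g = (\<lambda>h. g \<otimes> h \<otimes> inv g) ` H"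
      by (auto simp: l_coset_def r_coset_def)
    moreover have "inj_on (\<lambda>h. g \<otimes> h \<otimes> inv g) H"
      using s that by (auto intro!: inj_onI simp: subset_iff)
    ultimately show ?thesis by (simp add: card_image)
  qed
  have refl: "C \<sqsubseteq>\<^bsub>?P\<^esub> C" if C: "C \<in> carrier ?P" for C
  proof -
    obtain H where H: "subgroup H G" "C = subgroup_class G H" using C unfolding carr by auto
    have "\<one> <# H #> inv \<one> \<subseteq> H" using conj_one H subgroup.subset by blast
    then show ?thesis
      unfolding H(2) le[OF H(1) H(1)] by blast
  qed
  have trans: "C \<sqsubseteq>\<^bsub>?P\<^esub> E" if C: "C \<sqsubseteq>\<^bsub>?P\<^esub> D" "D \<sqsubseteq>\<^bsub>?P\<^esub> E"
    "C \<in> carrier ?P" "D \<in> carrier ?P" "E \<in> carrier ?P" for C D E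
  proof -
    obtain H K M where *: "subgroup H G" "C = subgroup_class G H" "subgroup K G"
      "D = subgroup_class G K" "subgroup M G" "E = subgroup_class G M"
      using C(3-5) unfolding carr by blast
    obtain a b where ab: "a \<in> carrier G" "b \<in> carrier G" "a <# H #> inv a \<subseteq> K" "b <# K #> inv b \<subseteq> M"
      using C(1,2) unfolding *(2,4,6) le[OF *(1,3)] le[OF *(3,5)] by blast
    have "b <# (a <# H #> inv a) #> inv b \<subseteq> b <# K #> inv b"
      using ab(3) by (auto simp: l_coset_def r_coset_def)
    then have "(b \<otimes> a) <# H #> inv (b \<otimes> a) \<subseteq> M"
      using ab conj_conj[OF ab(1,2) subgroup.subset[OF *(1)]] by blast
    then show ?thesis
      unfolding *(2,6) le[OF *(1,5)] using ab by blast
  qed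
  have antisym: "C = D" if C: "C \<sqsubseteq>\<^bsub>?P\<^esub> D" "D \<sqsubseteq>\<^bsub>?P\<^esub> C" "C \<in> carrier ?P" "D \<in> carrier ?P" for C D
  proof -
    obtain H K where *: "subgroup H G" "C = subgroup_class G H" "subgroup K G"
      "D = subgroup_class G K"
      using C(3,4) unfolding carr by blast
    obtain a b where ab: "a \<in> carrier G" "b \<in> carrier G" "a <# H #> inv a \<subseteq> K" "b <# K #> inv b \<subseteq> H"
      using C(1,2) unfolding *(2,4) le[OF *(1,3)] le[OF *(3,1)] by blast
    have f: "finite H" "finite K"
      using finite_subset[OF subgroup.subset fin] * by simp_all
    have "card K \<le> card H"
      using card_mono[OF f(1) ab(4)] card_conj ab * by simp
    then have "a <# H #> inv a = K"
      using f ab * card_conj by (intro card_seteq) auto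
    then show ?thesis
      unfolding *(2,4) subgroup_class_eq_iff[OF *(1,3)] using ab(1) by blast
  qed
  show ?thesis
    by unfold_locales (simp_all add: eq refl antisym, (erule (4) trans)?)
qed

lemma (in group) finite_subgroup_lattice:
  assumes "finite (carrier G)"
  shows "finite (carrier (subgroup_lattice G))" "finite (carrier (subgroup_class_poset G))"
  using finite_subgroups[OF assms] by (simp_all add: subgroup_lattice_def subgroup_class_poset_def)

end

theory Submission
  imports Defs
begin

text \<open>Write \<open>T(H) = N\<^sub>G(H) \<inter> G'H\<close>. Since \<open>|N\<^bsub>G'\<^esub>(H) : G' \<inter> H| = |T(H)| / |H|\<close>, the property reads
  \<open>\<mu>(H,G) |H| = |T(H)| \<lambda>(H,G)\<close>, and in this form it passes between \<open>G/N\<close> and the subgroups of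
  \<open>G\<close> containing \<open>N\<close>. From there one descends to the trivial subgroup along chief factors \<open>B/A\<close> of
  \<open>G\<close> below \<open>N\<close>, which are abelian. If \<open>A \<le> H\<close> and \<open>B\<close> is not contained in \<open>H\<close>, then
  \<open>\<mu>(H,G) = - \<mu>(HB,G) c\<close> and \<open>\<lambda>(H,G) = - \<lambda>(HB,G) c'\<close>, where \<open>c\<close> is the number of complements
  \<open>M \<ge> H\<close> of \<open>B\<close> modulo \<open>A\<close> and \<open>c'\<close> the number of their conjugacy classes; both are instances of
  one fact on finite posets. It remains to see that \<open>c |T(HB)| |H| = c' |T(H)| |HB|\<close>. If \<open>B/A\<close>
  is central, the complements are normal and contain \<open>G'\<close>, so \<open>c = c'\<close>; otherwise
  \<open>B \<le> G'A\<close>, and each class meets the complements above \<open>H\<close> in \<open>|N\<^sub>B(H) : A|\<close> members.\<close>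

subsection \<open>Moebius functions into a greatest element\<close>

text \<open>The poset of classes need not be a lattice, so complement formulas for lattices do not
  apply directly to \<lambda>. What survives is that B is normal: H \<mapsto> HB commutes with
  conjugation and acts on classes as a closure operator. The poset fact is therefore stated for a
  closure operator, without joins or meets. Commutativity of B/A makes H \<inter> B normal in HB
  when A \<le> H. If HB = G, the chief condition leaves only H \<inter> B = A or B, so every proper
  such H is a complement. Commutativity itself comes from solvability: B'A is normal in G and lies
  between A and B, and B'A = B would keep B, modulo A, inside every term of the derived series of N.
  The index is traded for T(H) because H and T(H) contain N as soon as H does, so that G/N divides
  both orders by |N|; N_{G'}(H) and G' \<inter> H need not contain N. If no complement contains H,
  both counts are 0 and both Moebius values vanish, so this case agrees with the formula
  too.\<close>

lemma (in partial_order) moebius_top_eqI: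
  assumes fin: "finite (carrier L)" and x: "x \<in> carrier L" and t: "t \<in> carrier L"
    and top: "\<And>y. y \<in> carrier L \<Longrightarrow> y \<sqsubseteq> t"
    and f: "\<And>z. z \<in> carrier L \<Longrightarrow> x \<sqsubseteq> z \<Longrightarrow>
      (\<Sum>y \<in> {y \<in> carrier L. z \<sqsubseteq> y}. f y) = (if z = t then 1 else 0)"
  shows "moebius L x t = f x"
proof -
  define m where "m = moebius L"
  have m: "is_moebius L m"
    unfolding m_def by (rule is_moebius_moebius) (use fin partial_order_axioms in auto)
  have m_sum: "(\<Sum>z \<in> {z \<in> carrier L. x \<sqsubseteq> z \<and> z \<sqsubseteq> y}. m x z) = (if x = y then 1 else 0)"
    if "y \<in> carrier L" "x \<sqsubseteq> y" for y
  proof (cases "x = y")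
    case True
    then have "{z \<in> carrier L. x \<sqsubseteq> z \<and> z \<sqsubseteq> y} = {x}"
      using x le_antisym by auto
    then show ?thesis using m x True by (simp add: is_moebius_def)
  next
    case False
    then show ?thesis using m x that by (auto simp: is_moebius_def)
  qed
  define U where "U = {z \<in> carrier L. x \<sqsubseteq> z}"
  have finU: "finite U" using fin by (simp add: U_def)
  \<comment> \<open>The double sum of \<open>m x z * f y\<close> over x \<le> z \<le> y is evaluated
    twice. Summing over \<open>y\<close> first leaves \<open>m x t\<close>, by the hypothesis on
    \<open>f\<close>; summing over \<open>z\<close> first leaves \<open>f x\<close>, by the defining
    recursion of \<open>m\<close>.\<close>
  have "m x t = (\<Sum>z\<in>U. m x z * (if z = t then 1 else 0))"
    using x t top by (subst sum.mono_neutral_right[of U "{t}"]) (auto simp: finU, auto simp: U_def)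
  also have "\<dots> = (\<Sum>z\<in>U. m x z * (\<Sum>y \<in> {y \<in> U. z \<sqsubseteq> y}. f y))"
  proof (rule sum.cong)
    fix z assume z: "z \<in> U"
    then have "{y \<in> carrier L. z \<sqsubseteq> y} = {y \<in> U. z \<sqsubseteq> y}"
      using x by (auto simp: U_def intro: le_trans[of x z])
    then show "m x z * (if z = t then 1 else 0) = m x z * (\<Sum>y \<in> {y \<in> U. z \<sqsubseteq> y}. f y)"
      using f[of z] z by (simp add: U_def)
  qed simp
  also have "\<dots> = (\<Sum>z\<in>U. \<Sum>y \<in> {y \<in> U. z \<sqsubseteq> y}. m x z * f y)"
    by (simp add: sum_distrib_left)
  also have "\<dots> = (\<Sum>y\<in>U. \<Sum>z \<in> {z \<in> U. z \<sqsubseteq> y}. m x z * f y)"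
    using finU by (intro sum.swap_restrict)
  also have "\<dots> = (\<Sum>y\<in>U. (if x = y then 1 else 0) * f y)"
  proof (rule sum.cong)
    fix y assume y: "y \<in> U"
    then have "{z \<in> U. z \<sqsubseteq> y} = {z \<in> carrier L. x \<sqsubseteq> z \<and> z \<sqsubseteq> y}"
      by (auto simp: U_def)
    then show "(\<Sum>z \<in> {z \<in> U. z \<sqsubseteq> y}. m x z * f y) = (if x = y then 1 else 0) * f y"
      using m_sum[of y] y by (simp add: U_def flip: sum_distrib_right)
  qed simp
  also have "\<dots> = f x"
    using x by (subst sum.mono_neutral_right[of U "{x}"]) (auto simp: finU, auto simp: U_def)
  finally show ?thesis by (simp add: m_def)
qed

text \<open>The defining recursion runs in the upper argument; this is the one in the lower
  argument. The Moebius function of the dual order, started at \<open>t\<close>, satisfies it by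
  definition, and \<open>moebius_top_eqI\<close> identifies that function with
  \<open>moebius L y t\<close>.\<close>

lemma (in partial_order) sum_moebius_top:
  assumes fin: "finite (carrier L)" and x: "x \<in> carrier L" and t: "t \<in> carrier L"
    and top: "\<And>y. y \<in> carrier L \<Longrightarrow> y \<sqsubseteq> t"
  shows "(\<Sum>y \<in> {y \<in> carrier L. x \<sqsubseteq> y}. moebius L y t) = (if x = t then 1 else 0)"
proof -
  let ?D = "inv_gorder L"
  define f where "f = moebius ?D t"
  have D: "is_moebius ?D (moebius ?D)"
    by (rule is_moebius_moebius) (use fin dual_order in auto)
  have f: "(\<Sum>y \<in> {y \<in> carrier L. z \<sqsubseteq> y}. f y) = (if z = t then 1 else 0)"
    if z: "z \<in> carrier L" for z
  proof (cases "z = t")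
    case True
    then have "{y \<in> carrier L. z \<sqsubseteq> y} = {t}"
      using z top le_antisym by auto
    then show ?thesis using D t True by (simp add: f_def is_moebius_def)
  next
    case False
    have "(\<Sum>y \<in> {y \<in> carrier ?D. t \<sqsubseteq>\<^bsub>?D\<^esub> y \<and> y \<sqsubseteq>\<^bsub>?D\<^esub> z}. f y) = 0"
      using D t z False top unfolding is_moebius_def f_def by auto
    moreover have "{y \<in> carrier ?D. t \<sqsubseteq>\<^bsub>?D\<^esub> y \<and> y \<sqsubseteq>\<^bsub>?D\<^esub> z} = {y \<in> carrier L. z \<sqsubseteq> y}"
      using top by auto
    ultimately show ?thesis using False by simp
  qed
  have "moebius L y t = f y" if "y \<in> carrier L" for y
    by (rule moebius_top_eqI) (use fin t top that f in auto)
  then have "(\<Sum>y \<in> {y \<in> carrier L. x \<sqsubseteq> y}. moebius L y t) = (\<Sum>y \<in> {y \<in> carrier L. x \<sqsubseteq> y}. f y)"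
    by (intro sum.cong) auto
  then show ?thesis using f x by simp
qed

text \<open>The recursion in the lower argument sees only the elements above \<open>x\<close>, so an
  order isomorphism from an upward closed part \<open>Q\<close> onto \<open>L'\<close> carries the
  values over. Injectivity of \<open>\<phi>\<close> on \<open>Q\<close> comes from order reflection
  and antisymmetry. For a quotient map, \<open>Q\<close> is the part above the kernel.\<close>

lemma moebius_top_iso:
  fixes L (structure) and L' (structure)
  assumes "partial_order L" "partial_order L'" and fin: "finite (carrier L)" "finite (carrier L')"
    and t: "t \<in> Q" and top: "\<And>y. y \<in> carrier L \<Longrightarrow> y \<sqsubseteq>\<^bsub>L\<^esub> t"
    and top': "\<And>y. y \<in> carrier L' \<Longrightarrow> y \<sqsubseteq>\<^bsub>L'\<^esub> \<phi> t"
    and Q: "Q \<subseteq> carrier L" "\<And>x y. x \<in> Q \<Longrightarrow> y \<in> carrier L \<Longrightarrow> x \<sqsubseteq>\<^bsub>L\<^esub> y \<Longrightarrow> y \<in> Q"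
    and bij: "\<phi> ` Q = carrier L'"
    and iso: "\<And>x y. x \<in> Q \<Longrightarrow> y \<in> Q \<Longrightarrow> \<phi> x \<sqsubseteq>\<^bsub>L'\<^esub> \<phi> y \<longleftrightarrow> x \<sqsubseteq>\<^bsub>L\<^esub> y"
    and x: "x \<in> Q"
  shows "moebius L x t = moebius L' (\<phi> x) (\<phi> t)"
proof -
  interpret L: partial_order L by fact
  interpret L': partial_order L' by fact
  have inj: "inj_on \<phi> Q"
  proof (rule inj_onI)
    fix a b assume ab: "a \<in> Q" "b \<in> Q" "\<phi> a = \<phi> b"
    then have "\<phi> a \<sqsubseteq>\<^bsub>L'\<^esub> \<phi> b" "\<phi> b \<sqsubseteq>\<^bsub>L'\<^esub> \<phi> a" using bij by auto
    then show "a = b" using ab Q(1) iso[of a b] iso[of b a] by (intro L.le_antisym) blast+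
  qed
  show ?thesis
  proof (rule L.moebius_top_eqI[where f = "\<lambda>x. moebius L' (\<phi> x) (\<phi> t)"])
    fix z assume z: "z \<in> carrier L" "x \<sqsubseteq>\<^bsub>L\<^esub> z"
    then have zQ: "z \<in> Q" using x Q by blast
    have "bij_betw \<phi> {y \<in> carrier L. z \<sqsubseteq>\<^bsub>L\<^esub> y} {y \<in> carrier L'. \<phi> z \<sqsubseteq>\<^bsub>L'\<^esub> y}"
    proof (rule bij_betw_imageI)
      have sub: "{y \<in> carrier L. z \<sqsubseteq>\<^bsub>L\<^esub> y} \<subseteq> Q" using zQ Q by blast
      then show "inj_on \<phi> {y \<in> carrier L. z \<sqsubseteq>\<^bsub>L\<^esub> y}" by (rule inj_on_subset[OF inj])
      have "{y \<in> carrier L. z \<sqsubseteq>\<^bsub>L\<^esub> y} = {y \<in> Q. \<phi> z \<sqsubseteq>\<^bsub>L'\<^esub> \<phi> y}"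
        using iso zQ sub Q by blast
      then show "\<phi> ` {y \<in> carrier L. z \<sqsubseteq>\<^bsub>L\<^esub> y} = {y \<in> carrier L'. \<phi> z \<sqsubseteq>\<^bsub>L'\<^esub> y}"
        using bij by auto
    qed
    then have "(\<Sum>y \<in> {y \<in> carrier L. z \<sqsubseteq>\<^bsub>L\<^esub> y}. moebius L' (\<phi> y) (\<phi> t)) =
        (\<Sum>y \<in> {y \<in> carrier L'. \<phi> z \<sqsubseteq>\<^bsub>L'\<^esub> y}. moebius L' y (\<phi> t))"
      by (rule sum.reindex_bij_betw)
    also have "\<dots> = (if \<phi> z = \<phi> t then 1 else 0)"
      by (rule L'.sum_moebius_top) (use fin top' bij t zQ in auto)
    also have "\<dots> = (if z = t then 1 else 0)"
      using inj t zQ by (auto dest: inj_onD)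
    finally show "(\<Sum>y \<in> {y \<in> carrier L. z \<sqsubseteq>\<^bsub>L\<^esub> y}. moebius L' (\<phi> y) (\<phi> t)) = (if z = t then 1 else 0)" .
  qed (use fin x t Q top in auto)
qed

text \<open>Here \<open>Q\<close> stands for the elements above a fixed one, \<open>J\<close> for the join with an element \<open>b\<close>,
  and \<open>S\<close> for a set of complements of \<open>b\<close>, below each of which \<open>J\<close> is an isomorphism onto the
  interval above \<open>b\<close>. The right-hand side, extended by \<open>moebius L x t\<close> to the \<open>x\<close> above \<open>b\<close>, satisfies
  the dual recursion of the Moebius function.\<close>

lemma (in partial_order) moebius_top_complements:
  assumes fin: "finite (carrier L)" and t: "t \<in> carrier L"
    and top: "\<And>y. y \<in> carrier L \<Longrightarrow> y \<sqsubseteq> t"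
    and Q: "Q \<subseteq> carrier L" "\<And>x y. x \<in> Q \<Longrightarrow> y \<in> carrier L \<Longrightarrow> x \<sqsubseteq> y \<Longrightarrow> y \<in> Q"
    and S: "S \<subseteq> Q"
    and J: "\<And>x. x \<in> Q \<Longrightarrow> J x \<in> Q" "\<And>x. x \<in> Q \<Longrightarrow> x \<sqsubseteq> J x" "\<And>x. x \<in> Q \<Longrightarrow> J (J x) = J x"
      "\<And>x y. x \<in> Q \<Longrightarrow> y \<in> Q \<Longrightarrow> x \<sqsubseteq> y \<Longrightarrow> J x \<sqsubseteq> J y"
      "\<And>x y. x \<in> Q \<Longrightarrow> y \<in> Q \<Longrightarrow> J x = x \<Longrightarrow> x \<sqsubseteq> y \<Longrightarrow> J y = y"
    and nofix: "\<And>M y. M \<in> S \<Longrightarrow> y \<in> Q \<Longrightarrow> y \<sqsubseteq> M \<Longrightarrow> J y \<noteq> y"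
    and refl: "\<And>M y z. M \<in> S \<Longrightarrow> y \<in> Q \<Longrightarrow> z \<in> Q \<Longrightarrow> y \<sqsubseteq> M \<Longrightarrow> z \<sqsubseteq> M \<Longrightarrow> J y \<sqsubseteq> J z \<Longrightarrow> y \<sqsubseteq> z"
    and surj: "\<And>M z. M \<in> S \<Longrightarrow> z \<in> Q \<Longrightarrow> J z = z \<Longrightarrow> \<exists>y\<in>Q. y \<sqsubseteq> M \<and> J y = z"
    and JS: "\<And>M. M \<in> S \<Longrightarrow> J M = t"
    and SI: "\<And>x. x \<in> Q \<Longrightarrow> J x = t \<Longrightarrow> x \<noteq> t \<Longrightarrow> x \<in> S"
    and x: "x \<in> Q" "J x \<noteq> x"
  shows "moebius L x t = - moebius L (J x) t * int (card {M \<in> S. x \<sqsubseteq> M})"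
proof -
  let ?m = "\<lambda>y. moebius L y t"
  define c where "c y = int (card {M \<in> S. y \<sqsubseteq> M})" for y
  define f where "f y = (if J y = y then ?m y else - ?m (J y) * c y)" for y
  have finQ: "finite Q" by (rule finite_subset[OF Q(1) fin])
  have finS: "finite S" by (rule finite_subset[OF S finQ])
  have msum: "(\<Sum>y \<in> {y \<in> Q. z \<sqsubseteq> y}. ?m y) = (if z = t then 1 else 0)" if "z \<in> Q" for z
  proof -
    have "{y \<in> Q. z \<sqsubseteq> y} = {y \<in> carrier L. z \<sqsubseteq> y}" using that Q by auto
    then show ?thesis using sum_moebius_top[OF fin _ t top] that Q by auto
  qed
  have "?m x = f x"
  proof (rule moebius_top_eqI[OF fin _ t top])
    fix z assume z: "z \<in> carrier L" "x \<sqsubseteq> z"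
    then have zQ: "z \<in> Q" using x Q by blast
    have Jz: "J z \<in> Q" "z \<sqsubseteq> J z" "J (J z) = J z" using J(1-3) zQ by auto
    have tr: "a \<sqsubseteq> b \<Longrightarrow> b \<sqsubseteq> c \<Longrightarrow> a \<in> Q \<Longrightarrow> b \<in> Q \<Longrightarrow> c \<in> Q \<Longrightarrow> a \<sqsubseteq> c" for a b c
      using le_trans Q by blast
    \<comment> \<open>The sum over the elements above \<open>z\<close> is split according to whether
      \<open>J\<close> fixes them. The fixed ones form the up-set of \<open>J z\<close>, so their
      Moebius values add up to 1 if \<open>J z = t\<close> and to 0 otherwise.\<close>
    have fixed: "{y \<in> Q. z \<sqsubseteq> y \<and> J y = y} = {y \<in> Q. J z \<sqsubseteq> y}"
    proof (intro equalityI subsetI CollectI; elim CollectE conjE)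
      fix y assume y: "y \<in> Q" "z \<sqsubseteq> y" "J y = y"
      then show "y \<in> Q \<and> J z \<sqsubseteq> y" using J(4)[of z y] zQ by simp
    next
      fix y assume y: "y \<in> Q" "J z \<sqsubseteq> y"
      then show "y \<in> Q \<and> z \<sqsubseteq> y \<and> J y = y" using J(5)[of "J z" y] Jz zQ tr by blast
    qed
    \<comment> \<open>Below one \<open>M\<close> of \<open>S\<close> no element is fixed, and
      \<open>J\<close> carries the elements between \<open>z\<close> and \<open>M\<close>
      bijectively onto the up-set of \<open>J z\<close>. The factor \<open>c y\<close> counts the
      \<open>M\<close> above \<open>y\<close>, so exchanging the two summations reduces the sum over
      the non-fixed elements to these.\<close>
    have below: "(\<Sum>y \<in> {y \<in> Q. (z \<sqsubseteq> y \<and> J y \<noteq> y) \<and> y \<sqsubseteq> M}. ?m (J y)) = (if J z = t then 1 else 0)"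
      if M: "M \<in> S" "z \<sqsubseteq> M" for M
    proof -
      have "bij_betw J {y \<in> Q. (z \<sqsubseteq> y \<and> J y \<noteq> y) \<and> y \<sqsubseteq> M} {y \<in> Q. J z \<sqsubseteq> y}"
      proof (rule bij_betw_imageI)
        show "inj_on J {y \<in> Q. (z \<sqsubseteq> y \<and> J y \<noteq> y) \<and> y \<sqsubseteq> M}"
        proof (rule inj_onI, clarify)
          fix a b assume ab: "a \<in> Q" "b \<in> Q" "a \<sqsubseteq> M" "b \<sqsubseteq> M" "J a = J b"
          moreover have "J b \<sqsubseteq> J b" using ab J(1) Q by auto
          ultimately have "a \<sqsubseteq> b" "b \<sqsubseteq> a" using refl[OF M(1)] by auto
          then show "a = b" using ab Q by (intro le_antisym) auto
        qed
        show "J ` {y \<in> Q. (z \<sqsubseteq> y \<and> J y \<noteq> y) \<and> y \<sqsubseteq> M} = {y \<in> Q. J z \<sqsubseteq> y}"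
        proof (intro equalityI subsetI)
          fix w assume "w \<in> {y \<in> Q. J z \<sqsubseteq> y}"
          then have w: "w \<in> Q" "J z \<sqsubseteq> w" by auto
          then have "J w = w" using J(5) Jz by blast
          then obtain y where y: "y \<in> Q" "y \<sqsubseteq> M" "J y = w" using surj M w by blast
          then have "z \<sqsubseteq> y" using refl M zQ w by blast
          then show "w \<in> J ` {y \<in> Q. (z \<sqsubseteq> y \<and> J y \<noteq> y) \<and> y \<sqsubseteq> M}"
            using y nofix M by blast
        qed (use J(1,4) zQ in auto)
      qed
      then have "(\<Sum>y \<in> {y \<in> Q. (z \<sqsubseteq> y \<and> J y \<noteq> y) \<and> y \<sqsubseteq> M}. ?m (J y)) = (\<Sum>y \<in> {y \<in> Q. J z \<sqsubseteq> y}. ?m y)"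
        by (rule sum.reindex_bij_betw)
      then show ?thesis using msum Jz by simp
    qed
    have "(\<Sum>y \<in> {y \<in> Q. z \<sqsubseteq> y \<and> J y \<noteq> y}. ?m (J y) * c y)
        = (\<Sum>y \<in> {y \<in> Q. z \<sqsubseteq> y \<and> J y \<noteq> y}. \<Sum>M \<in> {M \<in> S. y \<sqsubseteq> M}. ?m (J y))"
      by (simp add: c_def mult.commute)
    also have "\<dots> = (\<Sum>M\<in>S. \<Sum>y \<in> {y \<in> {y \<in> Q. z \<sqsubseteq> y \<and> J y \<noteq> y}. y \<sqsubseteq> M}. ?m (J y))"
      using finQ finS by (intro sum.swap_restrict) auto
    also have "\<dots> = (\<Sum>M\<in>S. if z \<sqsubseteq> M then (if J z = t then 1 else 0) else 0)"
    proof (rule sum.cong)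
      fix M assume M: "M \<in> S"
      show "(\<Sum>y \<in> {y \<in> {y \<in> Q. z \<sqsubseteq> y \<and> J y \<noteq> y}. y \<sqsubseteq> M}. ?m (J y)) =
        (if z \<sqsubseteq> M then (if J z = t then 1 else 0) else 0)"
      proof (cases "z \<sqsubseteq> M")
        case True
        then show ?thesis using below[OF M] by simp
      next
        case False
        then have "{y \<in> {y \<in> Q. z \<sqsubseteq> y \<and> J y \<noteq> y}. y \<sqsubseteq> M} = {}"
          using tr zQ M S by blast
        then show ?thesis using False by (simp only: sum.empty if_False)
      qed
    qed simp
    also have "\<dots> = (if J z = t then c z else 0)"
      using finS by (simp add: c_def sum.If_cases Int_def)
    finally have nonfixed: "(\<Sum>y \<in> {y \<in> Q. z \<sqsubseteq> y \<and> J y \<noteq> y}. ?m (J y) * c y) = (if J z = t then c z else 0)" .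
    have "{y \<in> carrier L. z \<sqsubseteq> y} = {y \<in> Q. z \<sqsubseteq> y}" using zQ Q by auto
    then have "(\<Sum>y \<in> {y \<in> carrier L. z \<sqsubseteq> y}. f y) =
      (\<Sum>y \<in> {y \<in> Q. z \<sqsubseteq> y \<and> J y = y} \<union> {y \<in> Q. z \<sqsubseteq> y \<and> J y \<noteq> y}. f y)"
      by (intro sum.cong) auto
    also have "\<dots> = (\<Sum>y \<in> {y \<in> Q. z \<sqsubseteq> y \<and> J y = y}. f y) + (\<Sum>y \<in> {y \<in> Q. z \<sqsubseteq> y \<and> J y \<noteq> y}. f y)"
      using finQ by (intro sum.union_disjoint) auto
    also have "(\<Sum>y \<in> {y \<in> Q. z \<sqsubseteq> y \<and> J y = y}. f y) = (\<Sum>y \<in> {y \<in> Q. z \<sqsubseteq> y \<and> J y = y}. ?m y)"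
      by (intro sum.cong) (auto simp: f_def)
    also have "\<dots> = (if J z = t then 1 else 0)"
      using msum Jz by (simp add: fixed)
    also have "(\<Sum>y \<in> {y \<in> Q. z \<sqsubseteq> y \<and> J y \<noteq> y}. f y) = - (\<Sum>y \<in> {y \<in> Q. z \<sqsubseteq> y \<and> J y \<noteq> y}. ?m (J y) * c y)"
      by (auto simp: f_def sum_negf[symmetric] intro!: sum.cong)
    also have "\<dots> = - (if J z = t then c z else 0)" by (simp only: nonfixed)
    \<comment> \<open>If \<open>z = t\<close>, no member of \<open>S\<close> lies above
      \<open>z\<close>. If \<open>J z = t\<close> but \<open>z\<close> is not \<open>t\<close>, then
      \<open>z\<close> itself belongs to \<open>S\<close> and is the only member above
      \<open>z\<close>, by \<open>refl\<close>, so the two terms cancel as 1 - 1. Otherwise both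
      terms are 0.\<close>
    also have "(if J z = t then 1 else 0) + - (if J z = t then c z else 0) = (if z = t then 1 else (0::int))"
    proof (cases "z = t")
      case True
      have "J t = t" using Jz top True Q t by (intro le_antisym) auto
      then have "{M \<in> S. z \<sqsubseteq> M} = {}" using nofix[OF _ zQ] True by auto
      then have "c z = 0" by (simp only: c_def card.empty of_nat_0)
      then show ?thesis using True \<open>J t = t\<close> by simp
    next
      case False
      show ?thesis
      proof (cases "J z = t")
        case True
        then have zS: "z \<in> S" using SI zQ False by blast
        have "M = z" if M: "M \<in> S" "z \<sqsubseteq> M" for M
        proof -
          have "M \<sqsubseteq> z"
            by (rule refl[OF M(1)]) (use M S zQ JS zS Q t in auto)
          then show ?thesis using M S zQ Q by (intro le_antisym) auto
        qed
        then have "{M \<in> S. z \<sqsubseteq> M} = {z}" using zS z by auto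
        then have "c z = 1" by (simp only: c_def card.empty card.insert_remove) simp
        then show ?thesis using True False by simp
      qed (use False in simp)
    qed
    finally show "(\<Sum>y \<in> {y \<in> carrier L. z \<sqsubseteq> y}. f y) = (if z = t then 1 else 0)" .
  qed (use x Q in auto)
  then show ?thesis using x by (simp add: f_def c_def)
qed

subsection \<open>Conjugation and normalizers\<close>

lemma card_constant_fibers:
  assumes "finite A" and "\<And>b. b \<in> f ` A \<Longrightarrow> card {a \<in> A. f a = b} = k"
  shows "card A = k * card (f ` A)"
proof -
  have "card A = (\<Sum>b \<in> f ` A. \<Sum>a \<in> {a \<in> A. f a = b}. 1)"
    using sum.image_gen[OF assms(1), of "\<lambda>_. 1::nat" f] by simp
  also have "\<dots> = (\<Sum>b \<in> f ` A. k)"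
    using assms(2) by (intro sum.cong) auto
  finally show ?thesis by simp
qed

text \<open>This is the \<open>T(H)\<close> of the introduction.\<close>

definition derived_normalizer :: "('a, 'b) monoid_scheme \<Rightarrow> 'a set \<Rightarrow> 'a set" where
  "derived_normalizer G H = normalizer G H \<inter> (derived G (carrier G) <#>\<^bsub>G\<^esub> H)"

text \<open>The statement carried down the chief factors: the hypothesis on the quotient supplies it
  at \<open>A = N\<close>, and at \<open>A = {\<one>}\<close> it is the goal with the index
  cleared.\<close>

definition mu_lambda_above :: "('a, 'b) monoid_scheme \<Rightarrow> 'a set \<Rightarrow> bool" where
  "mu_lambda_above G A \<longleftrightarrow> (\<forall>H. subgroup H G \<and> A \<subseteq> H \<longrightarrow>
     moebius_subgroups G H (carrier G) * int (card H) =
       int (card (derived_normalizer G H)) * moebius_classes G H (carrier G))"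

context group
begin

lemma inv_mult_cancel [simp]:
  assumes "x \<in> carrier G" "y \<in> carrier G"
  shows "x \<otimes> (inv x \<otimes> y) = y" "inv x \<otimes> (x \<otimes> y) = y"
  using assms by (simp_all flip: m_assoc)

lemma conj_eq_image: "g <# H #> inv g = (\<lambda>h. g \<otimes> h \<otimes> inv g) ` H"
  by (auto simp: l_coset_def r_coset_def)

lemma mem_conj:
  assumes "g \<in> carrier G" "H \<subseteq> carrier G"
  shows "x \<in> g <# H #> inv g \<longleftrightarrow> x \<in> carrier G \<and> inv g \<otimes> x \<otimes> g \<in> H"
proof
  assume "x \<in> g <# H #> inv g"
  then obtain h where h: "h \<in> H" "x = g \<otimes> h \<otimes> inv g" by (auto simp: conj_eq_image)
  then have "h \<in> carrier G" using assms by blast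
  then show "x \<in> carrier G \<and> inv g \<otimes> x \<otimes> g \<in> H" using h assms by (simp add: m_assoc)
next
  assume x: "x \<in> carrier G \<and> inv g \<otimes> x \<otimes> g \<in> H"
  then have "x = g \<otimes> (inv g \<otimes> x \<otimes> g) \<otimes> inv g" using assms by (simp add: m_assoc)
  then show "x \<in> g <# H #> inv g" using x unfolding conj_eq_image by blast
qed

lemma conj_closed: "g \<in> carrier G \<Longrightarrow> H \<subseteq> carrier G \<Longrightarrow> g <# H #> inv g \<subseteq> carrier G"
  by (auto simp: mem_conj)

lemma conj_mono: "H \<subseteq> K \<Longrightarrow> g <# H #> inv g \<subseteq> g <# K #> inv g"
  unfolding conj_eq_image by (rule image_mono)

lemma card_conj:
  assumes "g \<in> carrier G" "H \<subseteq> carrier G"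
  shows "card (g <# H #> inv g) = card H"
  unfolding conj_eq_image
  using assms by (intro card_image inj_onI) (auto simp: subset_iff)

lemma conj_normal:
  assumes "N \<lhd> G" "g \<in> carrier G"
  shows "g <# N #> inv g = N"
proof (intro equalityI subsetI)
  interpret N: normal N G by fact
  fix x
  show "x \<in> N" if "x \<in> g <# N #> inv g"
    using that assms(2) N.inv_op_closed2 by (auto simp: conj_eq_image)
  show "x \<in> g <# N #> inv g" if "x \<in> N"
    using that assms(2) N.inv_op_closed1 N.subset by (auto simp: mem_conj)
qed

lemma conj_set_mult:
  assumes "g \<in> carrier G" "H \<subseteq> carrier G" "K \<subseteq> carrier G"
  shows "g <# (H <#> K) #> inv g = (g <# H #> inv g) <#> (g <# K #> inv g)"
proof -
  have *: "g \<otimes> (h \<otimes> k) \<otimes> inv g = (g \<otimes> h \<otimes> inv g) \<otimes> (g \<otimes> k \<otimes> inv g)" if "h \<in> H" "k \<in> K" for h k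
  proof -
    have "h \<in> carrier G" "k \<in> carrier G" using that assms by auto
    then show ?thesis using assms by (simp add: m_assoc)
  qed
  show ?thesis
    unfolding conj_eq_image set_mult_def using * by (auto simp: image_UN)
qed

lemma mem_normalizer:
  assumes "H \<subseteq> carrier G"
  shows "g \<in> normalizer G H \<longleftrightarrow> g \<in> carrier G \<and> g <# H #> inv g = H"
  using assms by (simp add: normalizer_def stabilizer_def)

lemma mem_normalizer_finite:
  assumes "finite H" "H \<subseteq> carrier G"
  shows "g \<in> normalizer G H \<longleftrightarrow> g \<in> carrier G \<and> (\<forall>h\<in>H. g \<otimes> h \<otimes> inv g \<in> H)"
proof -
  have "g <# H #> inv g = H \<longleftrightarrow> g <# H #> inv g \<subseteq> H" if "g \<in> carrier G"
    using card_conj[OF that assms(2)] assms(1) card_seteq[of H "g <# H #> inv g"] by auto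
  then show ?thesis
    using assms(2) by (auto simp: mem_normalizer conj_eq_image image_subset_iff)
qed

lemma subgroup_subset_normalizer:
  assumes "subgroup H G"
  shows "H \<subseteq> normalizer G H"
proof
  interpret H: subgroup H G by fact
  fix h assume h: "h \<in> H"
  show "h \<in> normalizer G H"
    unfolding mem_normalizer[OF H.subset]
  proof (intro conjI subset_antisym)
    show "h <# H #> inv h \<subseteq> H"
      unfolding conj_eq_image using h by (intro image_subsetI H.m_closed H.m_inv_closed)
    show "H \<subseteq> h <# H #> inv h"
      using h H.subset by (intro subsetI) (simp add: mem_conj)
  qed (use h in simp)
qed

lemma mem_set_mult: "x \<in> H <#> K \<longleftrightarrow> (\<exists>h\<in>H. \<exists>k\<in>K. x = h \<otimes> k)"
  by (auto simp: set_mult_def)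

lemma subset_set_mult:
  assumes "subgroup H G" "subgroup K G"
  shows "H \<subseteq> H <#> K" "K \<subseteq> H <#> K"
proof -
  have "x = x \<otimes> \<one>" "y = \<one> \<otimes> y" if "x \<in> H" "y \<in> K" for x y
    using that assms by (simp_all add: subgroup.mem_carrier)
  then show "H \<subseteq> H <#> K" "K \<subseteq> H <#> K"
    using assms subgroup.one_closed unfolding mem_set_mult subset_iff by metis+
qed

lemma set_mult_subset:
  assumes "subgroup L G" "H \<subseteq> L" "K \<subseteq> L"
  shows "H <#> K \<subseteq> L"
  using assms by (auto simp: mem_set_mult intro!: subgroup.m_closed[OF assms(1)])

lemma set_mult_normal_subgroup:
  assumes "subgroup H G" "N \<lhd> G"
  shows "subgroup (H <#> N) G"
  using assms second_isomorphism_grp.normal_set_mult_subgroup commut_normal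
  by (metis second_isomorphism_grp.intro second_isomorphism_grp_axioms.intro)

text \<open>The pairs in \<open>H \<times> K\<close> with product h k are exactly (h z, inv z k)
  with z in \<open>H \<inter> K\<close>, so all fibres of the multiplication map have the same
  size.\<close>

lemma card_set_mult:
  assumes H: "subgroup H G" and K: "subgroup K G" and fin: "finite (carrier G)"
  shows "card H * card K = card (H <#> K) * card (H \<inter> K)"
proof -
  interpret H: subgroup H G by fact
  interpret K: subgroup K G by fact
  let ?f = "\<lambda>(h, k). h \<otimes> k"
  have f: "finite H" "finite K" using fin finite_subset H.subset K.subset by blast+
  have "card (H \<times> K) = card (H \<inter> K) * card (?f ` (H \<times> K))"
  proof (rule card_constant_fibers)
    fix b assume "b \<in> ?f ` (H \<times> K)"
    then obtain h k where hk: "h \<in> H" "k \<in> K" "b = h \<otimes> k" by auto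
    have "bij_betw (\<lambda>z. (h \<otimes> z, inv z \<otimes> k)) (H \<inter> K) {a \<in> H \<times> K. ?f a = b}"
    proof (rule bij_betw_imageI)
      show "inj_on (\<lambda>z. (h \<otimes> z, inv z \<otimes> k)) (H \<inter> K)"
        using hk by (intro inj_onI) auto
      show "(\<lambda>z. (h \<otimes> z, inv z \<otimes> k)) ` (H \<inter> K) = {a \<in> H \<times> K. ?f a = b}"
      proof (intro equalityI subsetI)
        fix a assume "a \<in> {a \<in> H \<times> K. ?f a = b}"
        then obtain h' k' where a: "a = (h', k')" "h' \<in> H" "k' \<in> K" "h' \<otimes> k' = h \<otimes> k"
          using hk by auto
        have e: "inv h \<otimes> h' = k \<otimes> inv k'"
        proof -
          have "inv h \<otimes> (h' \<otimes> k') \<otimes> inv k' = inv h \<otimes> (h \<otimes> k) \<otimes> inv k'" by (simp add: a)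
          then show ?thesis using a(2,3) hk(1,2) by (simp add: m_assoc)
        qed
        have "inv h \<otimes> h' \<in> H" using a(2) hk(1) by simp
        moreover have "inv h \<otimes> h' \<in> K" unfolding e using a(3) hk(2) by simp
        moreover have "a = (h \<otimes> (inv h \<otimes> h'), inv (inv h \<otimes> h') \<otimes> k)"
          using a(1-3) hk(1,2) by (simp add: inv_mult_group m_assoc flip: a(4))
        ultimately show "a \<in> (\<lambda>z. (h \<otimes> z, inv z \<otimes> k)) ` (H \<inter> K)" by blast
      qed (use hk in \<open>auto simp: m_assoc\<close>)
    qed
    then show "card {a \<in> H \<times> K. ?f a = b} = card (H \<inter> K)"
      using bij_betw_same_card by force
  qed (use f in simp)
  moreover have "?f ` (H \<times> K) = H <#> K" by (force simp: set_mult_def)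
  ultimately show ?thesis by (simp add: card_cartesian_product mult.commute)
qed

lemma subgroup_derived_normalizer:
  assumes "subgroup H G"
  shows "subgroup (derived_normalizer G H) G"
  unfolding derived_normalizer_def
  using assms normalizer_imp_subgroup[OF subgroup.subset] commut_normal[OF _ derived_self_is_normal]
    set_mult_normal_subgroup[OF _ derived_self_is_normal]
  by (intro subgroups_Inter_pair) auto

lemma subset_derived_normalizer:
  assumes "subgroup H G"
  shows "H \<subseteq> derived_normalizer G H"
  unfolding derived_normalizer_def
  using assms subgroup_subset_normalizer subset_set_mult(2) derived_is_subgroup by simp

text \<open>As H lies in its normalizer, the modular law gives T(H) = N_{G'}(H) H, and N_{G'}(H)
  meets H in G' \<inter> H. Lagrange and the product formula do the rest.\<close>

lemma subgroup_index_mult_card: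
  assumes fin: "finite (carrier G)" and H: "subgroup H G"
  shows "subgroup_index G (normalizer G H \<inter> derived G (carrier G)) (derived G (carrier G) \<inter> H) * card H
    = card (derived_normalizer G H)"
proof -
  let ?D = "derived G (carrier G)" and ?N = "normalizer G H"
  have D: "subgroup ?D G" by (simp add: derived_is_subgroup)
  have N: "subgroup ?N G" using normalizer_imp_subgroup subgroup.subset[OF H] .
  have ND: "subgroup (?N \<inter> ?D) G" using N D by (rule subgroups_Inter_pair)
  have DH: "subgroup (?D \<inter> H) G" using D H by (rule subgroups_Inter_pair)
  have sub: "H \<subseteq> ?N" by (rule subgroup_subset_normalizer) fact
  interpret K: group "G\<lparr>carrier := ?N \<inter> ?D\<rparr>" by (rule subgroup_imp_group) fact
  have "subgroup (?D \<inter> H) (G\<lparr>carrier := ?N \<inter> ?D\<rparr>)"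
    using DH ND sub by (intro subgroup_incl) auto
  from K.lagrange[OF this]
  have 1: "subgroup_index G (?N \<inter> ?D) (?D \<inter> H) * card (?D \<inter> H) = card (?N \<inter> ?D)"
    by (simp add: subgroup_index_def order_def)
  have "derived_normalizer G H = (?N \<inter> ?D) <#> H"
  proof (intro equalityI subsetI)
    fix x assume x: "x \<in> derived_normalizer G H"
    then obtain d h where dh: "d \<in> ?D" "h \<in> H" "x = d \<otimes> h"
      by (auto simp: derived_normalizer_def mem_set_mult)
    have c: "d \<in> carrier G" "h \<in> carrier G"
      using dh D H by (auto dest: subgroup.mem_carrier)
    have "x \<otimes> inv h \<in> ?N"
      using x dh sub N by (auto simp: derived_normalizer_def intro: subgroup.m_closed subgroup.m_inv_closed)
    then have "d \<in> ?N" using dh c by (simp add: m_assoc)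
    then show "x \<in> (?N \<inter> ?D) <#> H" using dh by (auto simp: mem_set_mult)
  next
    fix x assume "x \<in> (?N \<inter> ?D) <#> H"
    then show "x \<in> derived_normalizer G H"
      using sub N by (auto simp: derived_normalizer_def mem_set_mult intro: subgroup.m_closed)
  qed
  moreover have "(?N \<inter> ?D) \<inter> H = ?D \<inter> H" using sub by auto
  ultimately have 2: "card (?N \<inter> ?D) * card H = card (derived_normalizer G H) * card (?D \<inter> H)"
    using card_set_mult[OF ND H fin] by simp
  have "card (?D \<inter> H) > 0"
    using subgroup.finite_imp_card_positive[OF DH fin] .
  moreover have "(subgroup_index G (?N \<inter> ?D) (?D \<inter> H) * card H) * card (?D \<inter> H)
    = card (derived_normalizer G H) * card (?D \<inter> H)"
    using 1 2 by (metis mult.assoc mult.commute)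
  ultimately show ?thesis by simp
qed

lemma mu_lambda_property_iff:
  assumes fin: "finite (carrier G)"
  shows "mu_lambda_property G \<longleftrightarrow> mu_lambda_above G {\<one>}"
proof -
  have "(moebius_subgroups G H (carrier G) * int (card H) =
       int (card (derived_normalizer G H)) * moebius_classes G H (carrier G)) \<longleftrightarrow>
     moebius_subgroups G H (carrier G) =
          int (subgroup_index G (normalizer G H \<inter> derived G (carrier G))
                (derived G (carrier G) \<inter> H)) * moebius_classes G H (carrier G)"
    (is "?l \<longleftrightarrow> ?m = ?i * ?c") if H: "subgroup H G" for H
  proof -
    have pos: "card H > 0"
      using subgroup.finite_imp_card_positive[OF H fin] .
    have "?l \<longleftrightarrow> ?m * int (card H) = (?i * ?c) * int (card H)"
      unfolding subgroup_index_mult_card[OF fin H, symmetric] of_nat_mult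
      by (simp only: mult.assoc mult.commute mult.left_commute)
    then show ?thesis using pos by simp
  qed
  then show ?thesis
    unfolding mu_lambda_property_def mu_lambda_above_def
    using subgroup.one_closed by blast
qed

end

subsection \<open>Passing to a quotient\<close>

context group
begin

lemma subgroup_class_le_iff_conj:
  assumes "subgroup H G" "subgroup K G"
  shows "subgroup_class G H \<sqsubseteq>\<^bsub>subgroup_class_poset G\<^esub> subgroup_class G K \<longleftrightarrow>
    (\<exists>g \<in> carrier G. g <# H #> inv g \<subseteq> K)"
  using assms by (simp add: subgroup_class_le_iff conj_subset_iff subgroup.subset)

lemma normal_subset_conj:
  assumes "A \<lhd> G" "g \<in> carrier G" "A \<subseteq> H" "g <# H #> inv g \<subseteq> K"
  shows "A \<subseteq> K"
  using assms conj_mono[OF assms(3), of g] conj_normal[OF assms(1,2)] by simp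

lemma carrier_subgroup_class_poset:
  "carrier (subgroup_class_poset G) = subgroup_class G ` {H. subgroup H G}"
  by (simp add: subgroup_class_poset_def)

lemma subgroup_class_carrier_top:
  assumes "C \<in> carrier (subgroup_class_poset G)"
  shows "C \<sqsubseteq>\<^bsub>subgroup_class_poset G\<^esub> subgroup_class G (carrier G)"
proof -
  obtain H where H: "subgroup H G" "C = subgroup_class G H"
    using assms by (auto simp: carrier_subgroup_class_poset)
  then have "\<one> <# H #> inv \<one> \<subseteq> carrier G"
    by (intro conj_closed subgroup.subset) auto
  then show ?thesis
    using H subgroup_class_le_iff_conj[OF _ subgroup_self] by blast
qed

text \<open>Conjugation fixes the normal subgroup \<open>A\<close>, so lying above \<open>A\<close>
  does not depend on the representative of a class.\<close>

lemma subgroup_class_above_upclosed: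
  assumes A: "A \<lhd> G"
    and C: "C \<in> subgroup_class G ` {H. subgroup H G \<and> A \<subseteq> H}"
    and D: "D \<in> carrier (subgroup_class_poset G)" "C \<sqsubseteq>\<^bsub>subgroup_class_poset G\<^esub> D"
  shows "D \<in> subgroup_class G ` {H. subgroup H G \<and> A \<subseteq> H}"
proof -
  obtain H K where HK: "subgroup H G" "A \<subseteq> H" "C = subgroup_class G H"
    "subgroup K G" "D = subgroup_class G K"
    using C D(1) by (auto simp: carrier_subgroup_class_poset)
  then obtain g where "g \<in> carrier G" "g <# H #> inv g \<subseteq> K"
    using D(2) subgroup_class_le_iff_conj by blast
  then have "A \<subseteq> K" using normal_subset_conj[OF A] HK by blast
  then show ?thesis using HK by blast
qed

end

context group_hom
begin

lemma mem_of_image_mem: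
  assumes K: "subgroup K G" "kernel G H h \<subseteq> K" and x: "x \<in> carrier G" "h x \<in> h ` K"
  shows "x \<in> K"
proof -
  obtain k where k: "k \<in> K" "h x = h k" using x by auto
  have kc: "k \<in> carrier G" using subgroup.mem_carrier[OF K(1) k(1)] .
  then have "x \<otimes> inv k \<in> kernel G H h" using x k by (simp add: kernel_def)
  then have "(x \<otimes> inv k) \<otimes> k \<in> K" using subgroup.m_closed[OF K(1) _ k(1)] K(2) by blast
  then show ?thesis using kc x by (simp add: G.m_assoc)
qed

lemma image_subset_image_iff:
  assumes "subgroup K G" "kernel G H h \<subseteq> K" "L \<subseteq> carrier G"
  shows "h ` L \<subseteq> h ` K \<longleftrightarrow> L \<subseteq> K"
proof
  assume *: "h ` L \<subseteq> h ` K"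
  show "L \<subseteq> K"
  proof
    fix x assume "x \<in> L"
    then show "x \<in> K" using mem_of_image_mem[OF assms(1,2), of x] * assms(3) by auto
  qed
qed (rule image_mono)

lemma subgroup_preimage:
  assumes "subgroup L H"
  shows "subgroup {x \<in> carrier G. h x \<in> L} G"
proof (rule G.subgroupI)
  have "\<one> \<in> {x \<in> carrier G. h x \<in> L}" using subgroup.one_closed[OF assms] by simp
  then show "{x \<in> carrier G. h x \<in> L} \<noteq> {}" by blast
qed (use assms in \<open>auto intro: subgroup.m_closed subgroup.m_inv_closed\<close>)

lemma image_subgroups_above_kernel:
  assumes surj: "h ` carrier G = carrier H"
  shows "(`) h ` {K. subgroup K G \<and> kernel G H h \<subseteq> K} = {L. subgroup L H}"
proof (intro equalityI subsetI)
  fix L assume L: "L \<in> {L. subgroup L H}"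
  let ?K = "{x \<in> carrier G. h x \<in> L}"
  have "h ` ?K = L"
  proof (intro equalityI subsetI)
    fix y assume y: "y \<in> L"
    then have "y \<in> h ` carrier G" using L surj subgroup.subset by blast
    then show "y \<in> h ` ?K" using y by auto
  qed auto
  moreover have "kernel G H h \<subseteq> ?K"
    using L subgroup.one_closed by (auto simp: kernel_def)
  ultimately show "L \<in> (`) h ` {K. subgroup K G \<and> kernel G H h \<subseteq> K}"
    using subgroup_preimage[of L] L by (intro image_eqI[of _ _ ?K]) auto
qed (auto intro: subgroup_img_is_subgroup)

lemma image_conj:
  assumes "g \<in> carrier G" "K \<subseteq> carrier G"
  shows "h ` (g <# K #> inv g) = h g <#\<^bsub>H\<^esub> h ` K #>\<^bsub>H\<^esub> inv\<^bsub>H\<^esub> h g"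
  unfolding G.conj_eq_image H.conj_eq_image image_image
  using assms by (intro image_cong) auto

lemma image_subgroup_class:
  assumes surj: "h ` carrier G = carrier H" and K: "subgroup K G"
  shows "(`) h ` subgroup_class G K = subgroup_class H (h ` K)"
proof -
  have "(`) h ` subgroup_class G K = (\<lambda>g. h g <#\<^bsub>H\<^esub> h ` K #>\<^bsub>H\<^esub> inv\<^bsub>H\<^esub> h g) ` carrier G"
    unfolding G.subgroup_class_eq[OF K] image_image
    using image_conj subgroup.subset[OF K] by (intro image_cong) auto
  also have "\<dots> = (\<lambda>x. x <#\<^bsub>H\<^esub> h ` K #>\<^bsub>H\<^esub> inv\<^bsub>H\<^esub> x) ` h ` carrier G"
    by (simp only: image_image)
  finally show ?thesis
    using surj H.subgroup_class_eq[OF subgroup_img_is_subgroup[OF K]] by simp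
qed

lemma moebius_subgroups_image:
  assumes surj: "h ` carrier G = carrier H" and fin: "finite (carrier G)"
    and K: "subgroup K G" "kernel G H h \<subseteq> K"
  shows "moebius_subgroups G K (carrier G) = moebius_subgroups H (h ` K) (carrier H)"
proof -
  have finH: "finite (carrier H)" using surj fin by (metis finite_imageI)
  have "moebius (subgroup_lattice G) K (carrier G) = moebius (subgroup_lattice H) (h ` K) (h ` carrier G)"
  proof (rule moebius_top_iso[where Q = "{K. subgroup K G \<and> kernel G H h \<subseteq> K}"])
    show "carrier G \<in> {K. subgroup K G \<and> kernel G H h \<subseteq> K}"
      using G.subgroup_self by (auto simp: kernel_def)
    show "(`) h ` {K. subgroup K G \<and> kernel G H h \<subseteq> K} = carrier (subgroup_lattice H)"
      using image_subgroups_above_kernel[OF surj] by (simp add: subgroup_lattice_def)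
    fix A B assume "A \<in> {K. subgroup K G \<and> kernel G H h \<subseteq> K}" "B \<in> {K. subgroup K G \<and> kernel G H h \<subseteq> K}"
    then show "h ` A \<sqsubseteq>\<^bsub>subgroup_lattice H\<^esub> h ` B \<longleftrightarrow> A \<sqsubseteq>\<^bsub>subgroup_lattice G\<^esub> B"
      using image_subset_image_iff[of B A] subgroup.subset[of A G] by (simp add: subgroup_lattice_def)
  qed (use surj K fin finH G.partial_order_subgroup_lattice H.partial_order_subgroup_lattice
      G.finite_subgroup_lattice H.finite_subgroup_lattice
      in \<open>auto simp: subgroup_lattice_def dest: subgroup.subset\<close>)
  then show ?thesis by (simp add: moebius_subgroups_def surj)
qed

text \<open>A class is a set of subgroups and is mapped by taking the image of each member. Every
  conjugating element of \<open>H\<close> lifts to \<open>G\<close> by surjectivity, and above the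
  kernel an inclusion of images comes from an inclusion of subgroups; so the map preserves and
  reflects the order of classes.\<close>

lemma moebius_classes_image:
  assumes surj: "h ` carrier G = carrier H" and fin: "finite (carrier G)"
    and K: "subgroup K G" "kernel G H h \<subseteq> K"
  shows "moebius_classes G K (carrier G) = moebius_classes H (h ` K) (carrier H)"
proof -
  have finH: "finite (carrier H)" using surj fin by (metis finite_imageI)
  let ?S = "{K. subgroup K G \<and> kernel G H h \<subseteq> K}"
  let ?Q = "subgroup_class G ` ?S"
  have self: "carrier G \<in> ?S"
    using G.subgroup_self by (auto simp: kernel_def)
  have img: "(`) h ` subgroup_class G A = subgroup_class H (h ` A)" if "A \<in> ?S" for A
    using that image_subgroup_class[OF surj] by blast
  have "moebius (subgroup_class_poset G) (subgroup_class G K) (subgroup_class G (carrier G)) =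
    moebius (subgroup_class_poset H) ((`) h ` subgroup_class G K) ((`) h ` subgroup_class G (carrier G))"
  proof (rule moebius_top_iso[where Q = ?Q])
    show "partial_order (subgroup_class_poset G)" "partial_order (subgroup_class_poset H)"
      "finite (carrier (subgroup_class_poset G))" "finite (carrier (subgroup_class_poset H))"
      using fin finH by (simp_all add: G.partial_order_subgroup_class_poset H.partial_order_subgroup_class_poset
        G.finite_subgroup_lattice H.finite_subgroup_lattice)
    show "subgroup_class G (carrier G) \<in> ?Q" using self by blast
    show "subgroup_class G K \<in> ?Q" using K by blast
    show "?Q \<subseteq> carrier (subgroup_class_poset G)"
      by (auto simp: G.carrier_subgroup_class_poset)
    show "D \<in> ?Q" if "C \<in> ?Q" "D \<in> carrier (subgroup_class_poset G)"
      "C \<sqsubseteq>\<^bsub>subgroup_class_poset G\<^esub> D" for C D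
      using G.subgroup_class_above_upclosed[OF normal_kernel that] .
    show "C \<sqsubseteq>\<^bsub>subgroup_class_poset G\<^esub> subgroup_class G (carrier G)"
      if "C \<in> carrier (subgroup_class_poset G)" for C
      using G.subgroup_class_carrier_top[OF that] .
    show "C \<sqsubseteq>\<^bsub>subgroup_class_poset H\<^esub> (`) h ` subgroup_class G (carrier G)"
      if "C \<in> carrier (subgroup_class_poset H)" for C
      using H.subgroup_class_carrier_top[OF that] img[OF self] surj by simp
    have "(`) ((`) h) ` ?Q = subgroup_class H ` (`) h ` ?S"
      unfolding image_image using img by (intro image_cong) auto
    then show "(`) ((`) h) ` ?Q = carrier (subgroup_class_poset H)"
      using image_subgroups_above_kernel[OF surj] by (simp add: H.carrier_subgroup_class_poset)
    fix C D assume "C \<in> ?Q" "D \<in> ?Q"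
    then obtain A B where AB: "A \<in> ?S" "C = subgroup_class G A" "B \<in> ?S" "D = subgroup_class G B"
      by blast
    then have s: "subgroup A G" "subgroup B G" "subgroup (h ` A) H" "subgroup (h ` B) H"
      using subgroup_img_is_subgroup by auto
    have "(\<exists>x\<in>carrier H. x <#\<^bsub>H\<^esub> h ` A #>\<^bsub>H\<^esub> inv\<^bsub>H\<^esub> x \<subseteq> h ` B) \<longleftrightarrow>
      (\<exists>g\<in>carrier G. h ` (g <# A #> inv g) \<subseteq> h ` B)"
      using image_conj[OF _ subgroup.subset[OF s(1)]] by (simp flip: surj)
    also have "\<dots> \<longleftrightarrow> (\<exists>g\<in>carrier G. g <# A #> inv g \<subseteq> B)"
      using image_subset_image_iff[of B] G.conj_closed subgroup.subset[OF s(1)] AB by blast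
    finally show "(`) h ` C \<sqsubseteq>\<^bsub>subgroup_class_poset H\<^esub> (`) h ` D \<longleftrightarrow>
        C \<sqsubseteq>\<^bsub>subgroup_class_poset G\<^esub> D"
      unfolding AB img[OF AB(1)] img[OF AB(3)] G.subgroup_class_le_iff_conj[OF s(1,2)]
        H.subgroup_class_le_iff_conj[OF s(3,4)] .
  qed
  then show ?thesis by (simp add: moebius_classes_def img[OF self] image_subgroup_class[OF surj K(1)] surj)
qed

text \<open>The conjugates of \<open>K\<close> contain the kernel as \<open>K\<close> does, so the
  normalizer can be read off in the image. The product G'K contains the kernel as well, which is why
  taking images commutes with the intersection in \<open>derived_normalizer\<close>.\<close>

lemma image_derived_normalizer:
  assumes surj: "h ` carrier G = carrier H" and K: "subgroup K G" "kernel G H h \<subseteq> K"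
  shows "h ` derived_normalizer G K = derived_normalizer H (h ` K)"
proof -
  note Ks = subgroup.subset[OF K(1)]
  have hK: "subgroup (h ` K) H" using subgroup_img_is_subgroup[OF K(1)] .
  have norm: "h g \<in> normalizer H (h ` K) \<longleftrightarrow> g \<in> normalizer G K" if g: "g \<in> carrier G" for g
  proof -
    have c: "subgroup (g <# K #> inv g) G" using G.subgroup_conjugation_is_surj2[OF g K(1)] .
    have "kernel G H h \<subseteq> g <# K #> inv g"
      using G.conj_normal[OF normal_kernel g] G.conj_mono[OF K(2)] by blast
    then have "h ` (g <# K #> inv g) = h ` K \<longleftrightarrow> g <# K #> inv g = K"
      using image_subset_image_iff[OF K subgroup.subset[OF c]]
        image_subset_image_iff[OF c _ Ks] by blast
    then show ?thesis
      using g Ks subgroup.subset[OF hK] by (simp add: G.mem_normalizer H.mem_normalizer image_conj)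
  qed
  let ?D = "derived G (carrier G) <#> K"
  have D: "derived H (carrier H) <#>\<^bsub>H\<^esub> h ` K = h ` ?D"
    using set_mult_hom[OF homh G.derived_in_carrier Ks] derived_img[of "carrier G"] surj by simp
  have sub: "subgroup ?D G"
    using G.set_mult_normal_subgroup[OF K(1) G.derived_self_is_normal]
      G.commut_normal[OF K(1) G.derived_self_is_normal] by simp
  have ker: "kernel G H h \<subseteq> ?D"
    using K G.subset_set_mult(2)[OF G.derived_is_subgroup K(1)] by blast
  have "h g \<in> derived_normalizer H (h ` K) \<longleftrightarrow> g \<in> derived_normalizer G K" if g: "g \<in> carrier G" for g
    unfolding derived_normalizer_def D using norm[OF g] mem_of_image_mem[OF sub ker g] by (meson Int_iff imageI)
  moreover have "derived_normalizer H (h ` K) \<subseteq> h ` carrier G"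
    using surj subgroup.subset[OF H.subgroup_derived_normalizer[OF hK]] by simp
  moreover have "derived_normalizer G K \<subseteq> carrier G"
    using subgroup.subset[OF G.subgroup_derived_normalizer[OF K(1)]] .
  ultimately show ?thesis by blast
qed

lemma card_image_mult_kernel:
  assumes fin: "finite (carrier G)" and K: "subgroup K G" "kernel G H h \<subseteq> K"
  shows "card K = card (kernel G H h) * card (h ` K)"
proof (rule card_constant_fibers)
  show "finite K" using finite_subset[OF subgroup.subset[OF K(1)] fin] .
  fix b assume "b \<in> h ` K"
  then obtain k where k: "k \<in> K" "b = h k" by blast
  have kc: "k \<in> carrier G" using subgroup.mem_carrier[OF K(1) k(1)] .
  have "bij_betw (\<lambda>z. z \<otimes> k) (kernel G H h) {a \<in> K. h a = b}"
  proof (rule bij_betw_imageI)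
    show "inj_on (\<lambda>z. z \<otimes> k) (kernel G H h)"
      using kc by (intro inj_onI) (auto simp: kernel_def)
    show "(\<lambda>z. z \<otimes> k) ` kernel G H h = {a \<in> K. h a = b}"
    proof (intro equalityI subsetI)
      fix a assume "a \<in> {a \<in> K. h a = b}"
      then have a: "a \<in> carrier G" "h a = h k" using subgroup.mem_carrier[OF K(1)] k by auto
      then have "a \<otimes> inv k \<in> kernel G H h" using kc by (simp add: kernel_def)
      moreover have "a = (a \<otimes> inv k) \<otimes> k" using a kc by (simp add: G.m_assoc)
      ultimately show "a \<in> (\<lambda>z. z \<otimes> k) ` kernel G H h" by blast
    next
      fix a assume "a \<in> (\<lambda>z. z \<otimes> k) ` kernel G H h"
      then obtain z where z: "z \<in> kernel G H h" "a = z \<otimes> k" by blast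
      then have "a \<in> K" using subgroup.m_closed[OF K(1) _ k(1)] K(2) by blast
      then show "a \<in> {a \<in> K. h a = b}" using z k kc by (auto simp: kernel_def)
    qed
  qed
  then show "card {a \<in> K. h a = b} = card (kernel G H h)"
    using bij_betw_same_card by force
qed

text \<open>Passing to the image keeps both Moebius values and divides \<open>card K\<close> and
  \<open>card (derived_normalizer G K)\<close> by the order of the kernel, so the two sides of the
  equation scale alike.\<close>

lemma mu_lambda_above_kernel:
  assumes surj: "h ` carrier G = carrier H" and fin: "finite (carrier G)" and P: "mu_lambda_property H"
  shows "mu_lambda_above G (kernel G H h)"
  unfolding mu_lambda_above_def
proof (intro allI impI)
  fix K assume "subgroup K G \<and> kernel G H h \<subseteq> K"
  then have K: "subgroup K G" "kernel G H h \<subseteq> K" by auto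
  have "mu_lambda_above H {\<one>\<^bsub>H\<^esub>}"
    using P H.mu_lambda_property_iff surj fin by (metis finite_imageI)
  then have "moebius_subgroups H (h ` K) (carrier H) * int (card (h ` K)) =
    int (card (derived_normalizer H (h ` K))) * moebius_classes H (h ` K) (carrier H)"
    unfolding mu_lambda_above_def
    using subgroup_img_is_subgroup[OF K(1)] subgroup.one_closed by blast
  moreover have "card (derived_normalizer G K) = card (kernel G H h) * card (derived_normalizer H (h ` K))"
    using card_image_mult_kernel[OF fin G.subgroup_derived_normalizer[OF K(1)]]
      image_derived_normalizer[OF surj K] G.subset_derived_normalizer[OF K(1)] K(2) by simp
  ultimately show "moebius_subgroups G K (carrier G) * int (card K) =
      int (card (derived_normalizer G K)) * moebius_classes G K (carrier G)"
    using moebius_subgroups_image[OF surj fin K] moebius_classes_image[OF surj fin K]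
      card_image_mult_kernel[OF fin K] by (simp add: algebra_simps)
qed

end

lemma (in normal) mu_lambda_above_quotient:
  assumes fin: "finite (carrier G)" and P: "mu_lambda_property (G Mod H)"
  shows "mu_lambda_above G H"
proof -
  have hom: "group_hom G (G Mod H) ((#>) H)"
    by (intro group_hom.intro group_hom_axioms.intro factorgroup_is_group r_coset_hom_Mod is_group)
  have "kernel G (G Mod H) ((#>) H) = H"
    unfolding kernel_def one_FactGroup
    using coset_join1[OF _ _ subgroup_axioms] coset_join2[OF _ subgroup_axioms] mem_carrier by auto
  then show ?thesis
    using group_hom.mu_lambda_above_kernel[OF hom _ fin P] by (simp add: carrier_FactGroup)
qed

subsection \<open>Complements of an abelian chief factor\<close>

lemma (in group) mem_derived:
  assumes "x \<in> carrier G" "y \<in> carrier G"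
  shows "x \<otimes> y \<otimes> inv x \<otimes> inv y \<in> derived G (carrier G)"
  unfolding derived_def using assms by (blast intro: generate.incl)

lemma (in group) normal_set_mult:
  assumes "M \<lhd> G" "N \<lhd> G"
  shows "M <#> N \<lhd> G"
proof (rule normal_invI)
  have s: "subgroup M G" "subgroup N G" using assms normal_imp_subgroup by auto
  show "subgroup (M <#> N) G" using set_mult_normal_subgroup s assms by blast
  fix x h assume xh: "x \<in> carrier G" "h \<in> M <#> N"
  then have "x \<otimes> h \<otimes> inv x \<in> x <# (M <#> N) #> inv x" unfolding conj_eq_image by blast
  also have "\<dots> = M <#> N"
    using xh s assms by (simp add: conj_set_mult subgroup.subset conj_normal)
  finally show "x \<otimes> h \<otimes> inv x \<in> M <#> N" .
qed

text \<open>B/A is an abelian minimal normal subgroup of G/A. All conditions are phrased inside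
  \<open>G\<close>; the subgroups of G/A are represented by the members of
  \<open>above\<close>.\<close>

locale abelian_chief_factor = group G for G (structure) +
  fixes A B :: "'a set"
  assumes fin: "finite (carrier G)"
    and normal_A: "A \<lhd> G" and normal_B: "B \<lhd> G" and less: "A \<subset> B"
    and commutator_mem: "\<And>b c. b \<in> B \<Longrightarrow> c \<in> B \<Longrightarrow> b \<otimes> c \<otimes> inv b \<otimes> inv c \<in> A"
    and chief: "\<And>Z. Z \<lhd> G \<Longrightarrow> A \<subseteq> Z \<Longrightarrow> Z \<subseteq> B \<Longrightarrow> Z = A \<or> Z = B"
begin

sublocale A: normal A G by (rule normal_A)
sublocale B: normal B G by (rule normal_B)

definition above :: "'a set set" where
  "above = {H. subgroup H G \<and> A \<subseteq> H}"

definition complements :: "'a set set" where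
  "complements = {M. subgroup M G \<and> M \<inter> B = A \<and> M <#> B = carrier G}"

lemma complements_above: "M \<in> complements \<Longrightarrow> M \<in> above"
  by (auto simp: complements_def above_def)

lemma aboveD: "H \<in> above \<Longrightarrow> subgroup H G" "H \<in> above \<Longrightarrow> H \<subseteq> carrier G" "H \<in> above \<Longrightarrow> A \<subseteq> H"
  "H \<in> above \<Longrightarrow> finite H"
  using fin by (auto simp: above_def dest: subgroup.subset finite_subset)

lemma carrier_above: "carrier G \<in> above"
  using subgroup_self A.subset by (simp add: above_def)

lemma join_above: "H \<in> above \<Longrightarrow> H <#> B \<in> above"
  using set_mult_normal_subgroup[OF _ normal_B] subset_set_mult(1)[OF _ B.subgroup_axioms]
  by (auto simp: above_def)

lemma join_supset: "H \<in> above \<Longrightarrow> H \<subseteq> H <#> B" "H \<in> above \<Longrightarrow> B \<subseteq> H <#> B"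
  using subset_set_mult[OF _ B.subgroup_axioms] by (auto simp: above_def)

lemma join_subset: "L \<in> above \<Longrightarrow> H \<subseteq> L \<Longrightarrow> B \<subseteq> L \<Longrightarrow> H <#> B \<subseteq> L"
  by (rule set_mult_subset[OF aboveD(1)])

lemma join_eq_iff:
  assumes "H \<in> above"
  shows "H <#> B = H \<longleftrightarrow> B \<subseteq> H"
  using join_supset[OF assms] join_subset[OF assms, of H] by auto

lemma join_conj:
  assumes "H \<in> above" "g \<in> carrier G"
  shows "g <# (H <#> B) #> inv g = (g <# H #> inv g) <#> B"
  using assms aboveD B.subset by (simp add: conj_set_mult conj_normal[OF normal_B])

lemma conj_above:
  assumes "H \<in> above" "g \<in> carrier G"
  shows "g <# H #> inv g \<in> above"
  using assms subgroup_conjugation_is_surj2 normal_subset_conj[OF normal_A assms(2) _ subset_refl]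
  by (simp add: above_def)

lemma complement_not_ge:
  assumes "M \<in> complements" "K \<subseteq> M"
  shows "\<not> B \<subseteq> K"
  using assms less by (auto simp: complements_def)

text \<open>Together with \<open>modular_above\<close> this is Dedekind's law: K \<mapsto> KB and L
  \<mapsto> L \<inter> M are inverse isomorphisms between the subgroups from A to M and those from B
  to G. This supplies \<open>refl\<close> and \<open>surj\<close> of
  \<open>moebius_top_complements\<close>.\<close>

lemma modular_below:
  assumes M: "M \<in> complements" and K: "K \<in> above" "K \<subseteq> M"
  shows "M \<inter> (K <#> B) = K"
proof (intro equalityI subsetI)
  interpret M: subgroup M G using M by (simp add: complements_def)
  interpret K: subgroup K G using K aboveD by simp
  fix x assume x: "x \<in> M \<inter> (K <#> B)"
  then obtain k b where kb: "k \<in> K" "b \<in> B" "x = k \<otimes> b" by (auto simp: mem_set_mult)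
  have "b = inv k \<otimes> x" using kb by simp
  also have "\<dots> \<in> M" using kb(1) K(2) x by (intro M.m_closed M.m_inv_closed) auto
  finally have "b \<in> A" using M kb by (auto simp: complements_def)
  then have "b \<in> K" using K aboveD by blast
  then show "x \<in> K" using kb by simp
qed (use K join_supset in auto)

lemma modular_above:
  assumes M: "M \<in> complements" and L: "L \<in> above" "B \<subseteq> L"
  shows "(L \<inter> M) <#> B = L"
proof (intro equalityI subsetI)
  interpret L: subgroup L G using L aboveD by simp
  interpret M: subgroup M G using M by (simp add: complements_def)
  fix x assume x: "x \<in> L"
  then have "x \<in> M <#> B" using M by (simp add: complements_def)
  then obtain m b where mb: "m \<in> M" "b \<in> B" "x = m \<otimes> b" by (auto simp: mem_set_mult)
  have "m = x \<otimes> inv b" using mb by (simp add: m_assoc)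
  also have "\<dots> \<in> L" using x mb(2) L(2) by (intro L.m_closed L.m_inv_closed) auto
  finally show "x \<in> (L \<inter> M) <#> B" using mb by (auto simp: mem_set_mult)
next
  fix x assume "x \<in> (L \<inter> M) <#> B"
  then show "x \<in> L" using join_subset[OF L(1) _ L(2), of "L \<inter> M"] by auto
qed

text \<open>H \<inter> B is normal in G = HB. Conjugation by H preserves it because B is normal;
  conjugation by b in B changes an element h only by the commutator of b and h, which lies in A and
  hence in H. By \<open>chief\<close> the intersection is then A, as it is not B.\<close>

lemma complementI:
  assumes H: "H \<in> above" "H <#> B = carrier G" "\<not> B \<subseteq> H"
  shows "H \<in> complements"
proof -
  interpret H: subgroup H G using H aboveD by simp
  have "H \<inter> B \<lhd> G"
  proof (rule normal_invI)
    show "subgroup (H \<inter> B) G"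
      using H.subgroup_axioms B.subgroup_axioms by (rule subgroups_Inter_pair)
    fix x h assume x: "x \<in> carrier G" and h: "h \<in> H \<inter> B"
    then obtain k b where kb: "k \<in> H" "b \<in> B" "x = k \<otimes> b"
      using H(2) mem_set_mult by metis
    define y where "y = b \<otimes> h \<otimes> inv b"
    have "y = (b \<otimes> h \<otimes> inv b \<otimes> inv h) \<otimes> h"
      using kb h by (simp add: y_def m_assoc)
    moreover have "b \<otimes> h \<otimes> inv b \<otimes> inv h \<in> H"
      using commutator_mem[of b h] kb h H(1) aboveD by blast
    ultimately have y: "y \<in> H" using h by auto
    have "x \<otimes> h \<otimes> inv x = k \<otimes> y \<otimes> inv k"
      using kb h by (simp add: y_def m_assoc inv_mult_group)
    then have "x \<otimes> h \<otimes> inv x \<in> H" using y kb by simp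
    moreover have "x \<otimes> h \<otimes> inv x \<in> B" using x h B.inv_op_closed2 by auto
    ultimately show "x \<otimes> h \<otimes> inv x \<in> H \<inter> B" by blast
  qed
  then have "H \<inter> B = A"
    using chief[of "H \<inter> B"] H aboveD(3) less by blast
  then show ?thesis using H H.subgroup_axioms by (simp add: complements_def)
qed

lemma conj_complement:
  assumes M: "M \<in> complements" and g: "g \<in> carrier G"
  shows "g <# M #> inv g \<in> complements"
proof (rule complementI)
  have Ma: "M \<in> above" using M by (rule complements_above)
  show "g <# M #> inv g \<in> above" by (rule conj_above[OF Ma g])
  have "g <# carrier G #> inv g = carrier G" using conj_normal[OF normal_self g] .
  then show "(g <# M #> inv g) <#> B = carrier G"
    using M by (simp flip: join_conj[OF Ma g] add: complements_def)
  show "\<not> B \<subseteq> g <# M #> inv g"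
  proof
    assume "B \<subseteq> g <# M #> inv g"
    then have "inv g <# B #> inv (inv g) \<subseteq> inv g <# (g <# M #> inv g) #> inv (inv g)"
      by (rule conj_mono)
    then have "B \<subseteq> M"
      using g Ma aboveD conj_normal[OF normal_B, of "inv g"] conj_conj[of g "inv g" M] conj_one[of M] by simp
    then show False using complement_not_ge[OF M] by blast
  qed
qed

text \<open>With the factor from B on the left, conjugation by g = b m acts by m first, and this
  step stays inside M.\<close>

lemma complement_decompose:
  assumes M: "M \<in> complements" and g: "g \<in> carrier G"
  obtains b m where "b \<in> B" "m \<in> M" "g = b \<otimes> m"
proof -
  have "g \<in> B <#> M"
    using M g commut_normal[OF _ normal_B, of M] by (simp add: complements_def)
  then show ?thesis using that by (auto simp: mem_set_mult)
qed

section \<open>Moebius values through complements, for subgroups and for classes\<close>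

lemma moebius_subgroups_complements:
  assumes H: "H \<in> above" "\<not> B \<subseteq> H"
  shows "moebius_subgroups G H (carrier G) =
    - moebius_subgroups G (H <#> B) (carrier G) * int (card {M \<in> complements. H \<subseteq> M})"
proof -
  interpret L: partial_order "subgroup_lattice G" by (rule partial_order_subgroup_lattice)
  have le: "U \<sqsubseteq>\<^bsub>subgroup_lattice G\<^esub> Y \<longleftrightarrow> U \<subseteq> Y" for U Y
    by (simp add: subgroup_lattice_def)
  have carr: "carrier (subgroup_lattice G) = {H. subgroup H G}"
    by (simp add: subgroup_lattice_def)
  show ?thesis
    unfolding moebius_subgroups_def le[symmetric]
  proof (rule L.moebius_top_complements[where Q = above], unfold le carr)
    show "finite {H. subgroup H G}" using finite_subgroups fin .
    show "U \<subseteq> carrier G" if "U \<in> {H. subgroup H G}" for U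
      using that subgroup.subset by blast
    show "above \<subseteq> {H. subgroup H G}" "complements \<subseteq> above"
      using complements_above by (auto simp: above_def)
    show "Y \<in> above" if "U \<in> above" "Y \<in> {H. subgroup H G}" "U \<subseteq> Y" for U Y
      using that by (auto simp: above_def)
    show "U <#> B \<in> above" "U \<subseteq> U <#> B" "U <#> B <#> B = U <#> B" if "U \<in> above" for U
      using join_above[OF that] join_supset[OF that] join_eq_iff by auto
    show "U <#> B \<subseteq> Y <#> B" if "U \<subseteq> Y" for U Y
      using that by (intro mono_set_mult) auto
    show "Y <#> B = Y" if "U \<in> above" "Y \<in> above" "U <#> B = U" "U \<subseteq> Y" for U Y
      using that join_eq_iff by auto
    show "Y <#> B \<noteq> Y" if "M \<in> complements" "Y \<in> above" "Y \<subseteq> M" for M Y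
      using that complement_not_ge join_eq_iff by auto
    show "Y \<subseteq> Z" if "M \<in> complements" "Y \<in> above" "Z \<in> above" "Y \<subseteq> M" "Z \<subseteq> M" "Y <#> B \<subseteq> Z <#> B"
      for M Y Z
      using modular_below[OF that(1,2,4)] modular_below[OF that(1,3,5)] that(6) by blast
    show "\<exists>Y\<in>above. Y \<subseteq> M \<and> Y <#> B = Z" if "M \<in> complements" "Z \<in> above" "Z <#> B = Z" for M Z
    proof (intro bexI conjI)
      show "Z \<inter> M <#> B = Z" using modular_above that join_eq_iff by blast
      show "Z \<inter> M \<in> above"
        using that complements_above[OF that(1)] by (auto simp: above_def intro: subgroups_Inter_pair)
    qed auto
    show "M <#> B = carrier G" if "M \<in> complements" for M using that by (simp add: complements_def)
    show "U \<in> complements" if "U \<in> above" "U <#> B = carrier G" "U \<noteq> carrier G" for U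
      using that complementI join_eq_iff by metis
  qed (use H join_eq_iff carrier_above in \<open>auto simp: above_def\<close>)
qed

text \<open>Since B is fixed by conjugation, multiplying every member of a class by B yields a whole
  class again. This makes the join with B a function on classes that needs no choice of
  representatives.\<close>

lemma join_class:
  assumes "H \<in> above"
  shows "(\<lambda>K. K <#> B) ` subgroup_class G H = subgroup_class G (H <#> B)"
  unfolding subgroup_class_eq[OF aboveD(1)[OF assms]] subgroup_class_eq[OF aboveD(1)[OF join_above[OF assms]]]
    image_image using join_conj[OF assms] by simp

lemma class_le_iff:
  assumes "H \<in> above" "K \<in> above"
  shows "subgroup_class G H \<sqsubseteq>\<^bsub>subgroup_class_poset G\<^esub> subgroup_class G K \<longleftrightarrow>
    (\<exists>g \<in> carrier G. g <# H #> inv g \<subseteq> K)"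
  by (rule subgroup_class_le_iff_conj[OF aboveD(1)[OF assms(1)] aboveD(1)[OF assms(2)]])

lemma class_conj:
  assumes "H \<in> above" "g \<in> carrier G"
  shows "subgroup_class G (g <# H #> inv g) = subgroup_class G H"
  using assms subgroup_class_eq_iff[of H "g <# H #> inv g"] conj_above[OF assms] aboveD by blast

lemma class_le_complementD:
  assumes M: "M \<in> complements" and K: "K \<in> above"
    and le: "subgroup_class G K \<sqsubseteq>\<^bsub>subgroup_class_poset G\<^esub> subgroup_class G M"
  obtains K' where "K' \<in> above" "K' \<subseteq> M" "subgroup_class G K = subgroup_class G K'"
  using class_le_iff[OF K complements_above[OF M]] le class_conj[OF K] conj_above[OF K] that by metis

lemma class_join_eq_iff:
  assumes "H \<in> above"
  shows "subgroup_class G (H <#> B) = subgroup_class G H \<longleftrightarrow> B \<subseteq> H"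
proof
  assume "subgroup_class G (H <#> B) = subgroup_class G H"
  then obtain g where g: "g \<in> carrier G" "H = g <# (H <#> B) #> inv g"
    using subgroup_class_eq_iff assms join_above aboveD(1) by metis
  then show "B \<subseteq> H"
    using normal_subset_conj[OF normal_B g(1) join_supset(2)[OF assms]] by blast
qed (use join_eq_iff[OF assms] in simp)

lemma class_eq_top_iff:
  assumes "H \<in> above"
  shows "subgroup_class G H = subgroup_class G (carrier G) \<longleftrightarrow> H = carrier G"
proof
  assume "subgroup_class G H = subgroup_class G (carrier G)"
  then obtain g where "g \<in> carrier G" "H = g <# carrier G #> inv g"
    using subgroup_class_eq_iff assms subgroup_self aboveD(1) by metis
  then show "H = carrier G" using conj_normal[OF normal_self] by simp
qed simp

text \<open>The poset formula counts classes above that of H. Conjugating back, each such class of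
  complements has a representative that contains H itself.\<close>

lemma classes_above_complements:
  assumes H: "H \<in> above"
  shows "{C \<in> subgroup_class G ` complements. subgroup_class G H \<sqsubseteq>\<^bsub>subgroup_class_poset G\<^esub> C}
    = subgroup_class G ` {M \<in> complements. H \<subseteq> M}"
proof (intro equalityI subsetI)
  fix C assume "C \<in> {C \<in> subgroup_class G ` complements.
    subgroup_class G H \<sqsubseteq>\<^bsub>subgroup_class_poset G\<^esub> C}"
  then obtain M g where M: "M \<in> complements" "C = subgroup_class G M" "g \<in> carrier G"
    "g <# H #> inv g \<subseteq> M"
    using class_le_iff[OF H complements_above] by auto
  have "inv g <# (g <# H #> inv g) #> inv (inv g) \<subseteq> inv g <# M #> inv (inv g)"
    using M(4) by (rule conj_mono)
  then have "H \<subseteq> inv g <# M #> inv (inv g)"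
    using M(3) H aboveD conj_conj[of g "inv g" H] conj_one[of H] by simp
  moreover have "inv g <# M #> inv (inv g) \<in> complements"
    using M by (intro conj_complement) auto
  moreover have "C = subgroup_class G (inv g <# M #> inv (inv g))"
    unfolding M(2) by (rule class_conj[symmetric]) (use M complements_above in auto)
  ultimately show "C \<in> subgroup_class G ` {M \<in> complements. H \<subseteq> M}" by blast
next
  fix C assume "C \<in> subgroup_class G ` {M \<in> complements. H \<subseteq> M}"
  then obtain M where M: "M \<in> complements" "H \<subseteq> M" "C = subgroup_class G M" by blast
  have "\<one> <# H #> inv \<one> \<subseteq> M" using conj_one aboveD(2)[OF H] M by simp
  then show "C \<in> {C \<in> subgroup_class G ` complements.
      subgroup_class G H \<sqsubseteq>\<^bsub>subgroup_class_poset G\<^esub> C}"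
    unfolding M(3) mem_Collect_eq class_le_iff[OF H complements_above[OF M(1)]] using M(1) by blast
qed

text \<open>As \<open>G = BM\<close> and \<open>B\<close> normalizes \<open>LB\<close>, the conjugating element can be taken in \<open>M\<close>.\<close>

lemma class_order_reflecting:
  assumes M: "M \<in> complements" and K: "K \<in> above" "K \<subseteq> M" and L: "L \<in> above" "L \<subseteq> M"
    and le: "subgroup_class G (K <#> B) \<sqsubseteq>\<^bsub>subgroup_class_poset G\<^esub> subgroup_class G (L <#> B)"
  shows "subgroup_class G K \<sqsubseteq>\<^bsub>subgroup_class_poset G\<^esub> subgroup_class G L"
proof -
  interpret M: subgroup M G using M by (simp add: complements_def)
  interpret LB: subgroup "L <#> B" G using aboveD(1) join_above[OF L(1)] .
  obtain g where g: "g \<in> carrier G" "g <# (K <#> B) #> inv g \<subseteq> L <#> B"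
    using le unfolding class_le_iff[OF join_above[OF K(1)] join_above[OF L(1)]] by blast
  obtain b m where bm: "b \<in> B" "m \<in> M" "g = b \<otimes> m"
    using complement_decompose[OF M g(1)] .
  have "m <# K #> inv m \<subseteq> L"
  proof
    fix x assume "x \<in> m <# K #> inv m"
    then obtain k where k: "k \<in> K" "x = m \<otimes> k \<otimes> inv m" by (auto simp: conj_eq_image)
    then have c: "k \<in> carrier G" "m \<in> carrier G" "b \<in> carrier G" "x \<in> carrier G"
      using bm K aboveD by auto
    have "g \<otimes> k \<otimes> inv g \<in> L <#> B"
      using g(2) k(1) join_supset(1)[OF K(1)] unfolding conj_eq_image by blast
    moreover have "b \<in> L <#> B" using bm(1) join_supset(2)[OF L(1)] by blast
    ultimately have "inv b \<otimes> (g \<otimes> k \<otimes> inv g) \<otimes> b \<in> L <#> B" by simp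
    also have "inv b \<otimes> (g \<otimes> k \<otimes> inv g) \<otimes> b = x"
      using c by (simp add: bm(3) k(2) m_assoc inv_mult_group)
    finally have "x \<in> L <#> B" .
    moreover have "x \<in> M" using k bm(2) K by auto
    ultimately show "x \<in> L" using modular_below[OF M L] by blast
  qed
  then show ?thesis
    unfolding class_le_iff[OF K(1) L(1)] using M.mem_carrier[OF bm(2)] by blast
qed

text \<open>The closure operator is the join with B applied to each member of a class. A class below
  that of a complement M has a representative inside M; on such representatives
  \<open>class_order_reflecting\<close> gives \<open>refl\<close>, and \<open>modular_above\<close>
  gives \<open>surj\<close>.\<close>

lemma moebius_classes_complements:
  assumes H: "H \<in> above" "\<not> B \<subseteq> H"
  shows "moebius_classes G H (carrier G) =
    - moebius_classes G (H <#> B) (carrier G) *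
      int (card (subgroup_class G ` {M \<in> complements. H \<subseteq> M}))"
proof -
  let ?P = "subgroup_class_poset G" and ?cl = "subgroup_class G"
  let ?J = "(`) (\<lambda>K. K <#> B)"
  interpret P: partial_order ?P using fin by (rule partial_order_subgroup_class_poset)
  have Q_eq: "?cl ` above = ?cl ` {H. subgroup H G \<and> A \<subseteq> H}" by (simp add: above_def)
  have "moebius ?P (?cl H) (?cl (carrier G)) = - moebius ?P (?J (?cl H)) (?cl (carrier G)) *
    int (card {C \<in> ?cl ` complements. ?cl H \<sqsubseteq>\<^bsub>?P\<^esub> C})"
  proof (rule P.moebius_top_complements[where Q = "?cl ` above"])
    show "finite (carrier ?P)" using finite_subgroup_lattice fin by blast
    show "?cl (carrier G) \<in> carrier ?P"
      using subgroup_self by (auto simp: carrier_subgroup_class_poset)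
    show "C \<sqsubseteq>\<^bsub>?P\<^esub> ?cl (carrier G)" if "C \<in> carrier ?P" for C
      using subgroup_class_carrier_top[OF that] .
    show "?cl ` above \<subseteq> carrier ?P" "?cl ` complements \<subseteq> ?cl ` above"
      using complements_above by (auto simp: above_def carrier_subgroup_class_poset)
    show "D \<in> ?cl ` above" if "C \<in> ?cl ` above" "D \<in> carrier ?P" "C \<sqsubseteq>\<^bsub>?P\<^esub> D" for C D
      using subgroup_class_above_upclosed[OF normal_A that(1)[unfolded Q_eq] that(2,3)] unfolding Q_eq .
    fix C assume C: "C \<in> ?cl ` above"
    then obtain U where U: "U \<in> above" "C = ?cl U" by blast
    have JC: "?J C = ?cl (U <#> B)" using U join_class by simp
    have UB: "U <#> B \<in> above" using U join_above by simp
    show "?J C \<in> ?cl ` above" using JC UB by simp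
    have "\<one> <# U #> inv \<one> \<subseteq> U <#> B" using conj_one aboveD(2)[OF U(1)] join_supset(1)[OF U(1)] by simp
    then show "C \<sqsubseteq>\<^bsub>?P\<^esub> ?J C" unfolding JC unfolding U(2) class_le_iff[OF U(1) UB] by blast
    have "U <#> B <#> B = U <#> B" using join_eq_iff[OF UB] join_supset(2)[OF U(1)] by simp
    then show "?J (?J C) = ?J C" unfolding JC using join_class[OF UB] by simp
    have fixed: "?J C = C \<longleftrightarrow> B \<subseteq> U"
      unfolding JC unfolding U(2) using class_join_eq_iff[OF U(1)] .
    show "C \<in> ?cl ` complements" if "?J C = ?cl (carrier G)" "C \<noteq> ?cl (carrier G)"
    proof -
      have "U <#> B = carrier G" using that(1) JC class_eq_top_iff[OF UB] by simp
      moreover have "\<not> B \<subseteq> U" using fixed that by auto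
      ultimately show ?thesis using complementI U by blast
    qed
    fix D assume D: "D \<in> ?cl ` above"
    then obtain Y where Y: "Y \<in> above" "D = ?cl Y" by blast
    have JD: "?J D = ?cl (Y <#> B)" using Y join_class by simp
    have YB: "Y <#> B \<in> above" using Y join_above by simp
    show "?J C \<sqsubseteq>\<^bsub>?P\<^esub> ?J D" if le: "C \<sqsubseteq>\<^bsub>?P\<^esub> D"
    proof -
      obtain g where g: "g \<in> carrier G" "g <# U #> inv g \<subseteq> Y"
        using le unfolding U(2) Y(2) class_le_iff[OF U(1) Y(1)] by blast
      then have "g <# (U <#> B) #> inv g \<subseteq> Y <#> B"
        unfolding join_conj[OF U(1) g(1)] by (intro mono_set_mult) auto
      then show ?thesis unfolding JC JD class_le_iff[OF UB YB] using g by blast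
    qed
    show "?J D = D" if eq: "?J C = C" and le: "C \<sqsubseteq>\<^bsub>?P\<^esub> D"
    proof -
      obtain g where g: "g \<in> carrier G" "g <# U #> inv g \<subseteq> Y"
        using le unfolding U(2) Y(2) class_le_iff[OF U(1) Y(1)] by blast
      have "B \<subseteq> U" using fixed eq by simp
      then have "B \<subseteq> Y" using normal_subset_conj[OF normal_B g(1) _ g(2)] by simp
      then show ?thesis unfolding JD unfolding Y(2) using class_join_eq_iff[OF Y(1)] by simp
    qed
  next
    fix C0 assume "C0 \<in> ?cl ` complements"
    then obtain M where M: "M \<in> complements" "C0 = ?cl M" by blast
    note Ma = complements_above[OF M(1)]
    show "?J C0 = ?cl (carrier G)"
      using M join_class[OF Ma] by (simp add: complements_def)
    fix C assume C: "C \<in> ?cl ` above"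
    show "\<exists>Y\<in>?cl ` above. Y \<sqsubseteq>\<^bsub>?P\<^esub> C0 \<and> ?J Y = C" if "?J C = C"
    proof -
      obtain U where U: "U \<in> above" "C = ?cl U" using C by blast
      have BX: "B \<subseteq> U" using that class_join_eq_iff[OF U(1)] join_class[OF U(1)] U by simp
      have a: "U \<inter> M \<in> above" using U Ma by (auto simp: above_def intro: subgroups_Inter_pair)
      have "\<one> <# (U \<inter> M) #> inv \<one> \<subseteq> M" using conj_one aboveD(2)[OF a] by simp
      then have "?cl (U \<inter> M) \<sqsubseteq>\<^bsub>?P\<^esub> C0" unfolding M(2) class_le_iff[OF a Ma] by blast
      moreover have "?J (?cl (U \<inter> M)) = C"
        using join_class[OF a] modular_above[OF M(1) U(1) BX] U by simp
      ultimately show ?thesis using a by blast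
    qed
    assume CM: "C \<sqsubseteq>\<^bsub>?P\<^esub> C0"
    obtain U0 where "U0 \<in> above" "C = ?cl U0" using C by blast
    then obtain U where U: "U \<in> above" "U \<subseteq> M" "C = ?cl U"
      using class_le_complementD[OF M(1)] CM M(2) by metis
    have JC: "?J C = ?cl (U <#> B)" using U join_class by simp
    show "?J C \<noteq> C"
      unfolding JC unfolding U(3) using class_join_eq_iff[OF U(1)] complement_not_ge[OF M(1) U(2)] by blast
    fix D assume D: "D \<in> ?cl ` above" "D \<sqsubseteq>\<^bsub>?P\<^esub> C0" "?J C \<sqsubseteq>\<^bsub>?P\<^esub> ?J D"
    obtain Y0 where "Y0 \<in> above" "D = ?cl Y0" using D by blast
    then obtain Y where Y: "Y \<in> above" "Y \<subseteq> M" "D = ?cl Y"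
      using class_le_complementD[OF M(1)] D M(2) by metis
    show "C \<sqsubseteq>\<^bsub>?P\<^esub> D"
      unfolding U(3) Y(3)
      by (rule class_order_reflecting[OF M(1) U(1,2) Y(1,2)])
        (use D JC join_class Y in simp)
  next
    show "?cl H \<in> ?cl ` above" using H by simp
    show "?J (?cl H) \<noteq> ?cl H" using class_join_eq_iff[OF H(1)] join_class[OF H(1)] H(2) by simp
  qed
  then show ?thesis
    unfolding moebius_classes_def join_class[OF H(1)] classes_above_complements[OF H(1)] .
qed

end

subsection \<open>Counting complements\<close>

context abelian_chief_factor
begin

text \<open>The preimage in \<open>B\<close> of \<open>B/A \<inter> Z(G/A)\<close>, which is normal in \<open>G\<close>: the chief factor is
  central or meets the centre of \<open>G/A\<close> trivially.\<close>

definition centralizer_mod :: "'a set" where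
  "centralizer_mod = {z \<in> B. \<forall>g \<in> carrier G. z \<otimes> g \<otimes> inv z \<otimes> inv g \<in> A}"

lemma centralizer_mod_cases: "centralizer_mod = A \<or> centralizer_mod = B"
proof (rule chief)
  show "A \<subseteq> centralizer_mod"
  proof
    fix a assume a: "a \<in> A"
    have "a \<otimes> (g \<otimes> inv a \<otimes> inv g) \<in> A" if "g \<in> carrier G" for g
      using a that A.inv_op_closed2[OF that, of "inv a"] by simp
    then show "a \<in> centralizer_mod"
      using a less A.mem_carrier by (auto simp: centralizer_mod_def m_assoc)
  qed
  show "centralizer_mod \<subseteq> B" by (auto simp: centralizer_mod_def)
  \<comment> \<open>Each closure property rests on a commutator identity. Writing [z,g] for z g inv
    z inv g: [inv z,g] = inv z inv [z,g] z, [zw,g] = (z [w,g] inv z) [z,g], and [x z inv x, g] is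
    the conjugate by x of [z, inv x g x]. The right-hand sides lie in A because A is normal.\<close>
  show "centralizer_mod \<lhd> G"
  proof (rule normal_invI)
    show "subgroup centralizer_mod G"
    proof (rule subgroupI)
      show "centralizer_mod \<subseteq> carrier G" using B.subset by (auto simp: centralizer_mod_def)
      show "centralizer_mod \<noteq> {}" using \<open>A \<subseteq> centralizer_mod\<close> A.one_closed by blast
    next
      fix z assume z: "z \<in> centralizer_mod"
      then have zc: "z \<in> B" "z \<in> carrier G" by (auto simp: centralizer_mod_def)
      have "inv z \<otimes> g \<otimes> inv (inv z) \<otimes> inv g \<in> A" if g: "g \<in> carrier G" for g
      proof -
        have "z \<otimes> g \<otimes> inv z \<otimes> inv g \<in> A" using z g by (auto simp: centralizer_mod_def)
        then have "inv z \<otimes> inv (z \<otimes> g \<otimes> inv z \<otimes> inv g) \<otimes> z \<in> A"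
          using zc by (intro A.inv_op_closed1 A.m_inv_closed)
        also have "inv z \<otimes> inv (z \<otimes> g \<otimes> inv z \<otimes> inv g) \<otimes> z = inv z \<otimes> g \<otimes> inv (inv z) \<otimes> inv g"
          using zc g by (simp add: m_assoc inv_mult_group)
        finally show ?thesis .
      qed
      then show "inv z \<in> centralizer_mod" using zc by (auto simp: centralizer_mod_def)
    next
      fix z w assume zw: "z \<in> centralizer_mod" "w \<in> centralizer_mod"
      then have c: "z \<in> B" "z \<in> carrier G" "w \<in> B" "w \<in> carrier G"
        by (auto simp: centralizer_mod_def)
      have "(z \<otimes> w) \<otimes> g \<otimes> inv (z \<otimes> w) \<otimes> inv g \<in> A" if g: "g \<in> carrier G" for g
      proof -
        have "z \<otimes> g \<otimes> inv z \<otimes> inv g \<in> A" "w \<otimes> g \<otimes> inv w \<otimes> inv g \<in> A"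
          using zw g by (auto simp: centralizer_mod_def)
        then have "(z \<otimes> (w \<otimes> g \<otimes> inv w \<otimes> inv g) \<otimes> inv z) \<otimes> (z \<otimes> g \<otimes> inv z \<otimes> inv g) \<in> A"
          using A.m_closed A.inv_op_closed2[OF c(2)] by blast
        also have "(z \<otimes> (w \<otimes> g \<otimes> inv w \<otimes> inv g) \<otimes> inv z) \<otimes> (z \<otimes> g \<otimes> inv z \<otimes> inv g) =
            (z \<otimes> w) \<otimes> g \<otimes> inv (z \<otimes> w) \<otimes> inv g"
          using c g by (simp add: m_assoc inv_mult_group)
        finally show ?thesis .
      qed
      then show "z \<otimes> w \<in> centralizer_mod" using c by (auto simp: centralizer_mod_def)
    qed
    fix x z assume x: "x \<in> carrier G" and z: "z \<in> centralizer_mod"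
    then have c: "z \<in> B" "z \<in> carrier G" by (auto simp: centralizer_mod_def)
    have "(x \<otimes> z \<otimes> inv x) \<otimes> g \<otimes> inv (x \<otimes> z \<otimes> inv x) \<otimes> inv g \<in> A" if g: "g \<in> carrier G" for g
    proof -
      let ?g = "inv x \<otimes> g \<otimes> x"
      have "z \<otimes> ?g \<otimes> inv z \<otimes> inv ?g \<in> A"
        using z g x by (auto simp: centralizer_mod_def)
      then have "x \<otimes> (z \<otimes> ?g \<otimes> inv z \<otimes> inv ?g) \<otimes> inv x \<in> A" using x by (intro A.inv_op_closed2)
      also have "x \<otimes> (z \<otimes> ?g \<otimes> inv z \<otimes> inv ?g) \<otimes> inv x =
          (x \<otimes> z \<otimes> inv x) \<otimes> g \<otimes> inv (x \<otimes> z \<otimes> inv x) \<otimes> inv g"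
        using c g x by (simp add: m_assoc inv_mult_group)
      finally show ?thesis .
    qed
    then show "x \<otimes> z \<otimes> inv x \<in> centralizer_mod"
      using x c B.inv_op_closed2 by (auto simp: centralizer_mod_def)
  qed
qed

lemma card_join:
  assumes "H \<in> above" "H \<inter> B = A"
  shows "card H * card B = card (H <#> B) * card A"
  using card_set_mult[OF aboveD(1)[OF assms(1)] B.subgroup_axioms fin] assms(2) by simp

lemma below_complement_Int:
  assumes "M \<in> complements" "H \<in> above" "H \<subseteq> M"
  shows "H \<inter> B = A"
  using assms less aboveD(3) by (auto simp: complements_def)

text \<open>By \<open>modular_below\<close>, H = M \<inter> HB. An element of M normalizes M, so if
  it normalizes HB it normalizes the intersection.\<close>

lemma mem_normalizer_join_iff:
  assumes M: "M \<in> complements" and H: "H \<in> above" "H \<subseteq> M" and m: "m \<in> M"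
  shows "m \<in> normalizer G (H <#> B) \<longleftrightarrow> m \<in> normalizer G H"
proof -
  interpret M: subgroup M G using M by (simp add: complements_def)
  have mc: "m \<in> carrier G" using m by simp
  note HB = join_above[OF H(1)]
  have "m <# (H <#> B) #> inv m = H <#> B \<longleftrightarrow> m <# H #> inv m = H"
  proof
    assume *: "m <# (H <#> B) #> inv m = H <#> B"
    have "m <# H #> inv m \<subseteq> m <# (H <#> B) #> inv m"
      by (rule conj_mono[OF join_supset(1)[OF H(1)]])
    moreover have "m <# H #> inv m \<subseteq> M"
      unfolding conj_eq_image using m H(2) by (intro image_subsetI M.m_closed M.m_inv_closed) auto
    ultimately have "m <# H #> inv m \<subseteq> H"
      using modular_below[OF M H] * by blast
    then show "m <# H #> inv m = H"
      using card_conj[OF mc aboveD(2)[OF H(1)]] aboveD(4)[OF H(1)] by (intro card_subset_eq) auto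
  next
    assume "m <# H #> inv m = H"
    then show "m <# (H <#> B) #> inv m = H <#> B" using join_conj[OF H(1) mc] by simp
  qed
  then show ?thesis
    using mc aboveD(2)[OF HB] aboveD(2)[OF H(1)] by (simp add: mem_normalizer)
qed

lemma normalizer_subset_join:
  assumes "H \<in> above"
  shows "normalizer G H \<subseteq> normalizer G (H <#> B)"
  using join_conj[OF assms] aboveD(2)[OF assms] aboveD(2)[OF join_above[OF assms]]
  by (auto simp: mem_normalizer)

lemma normalizer_above: "H \<in> above \<Longrightarrow> normalizer G H \<in> above"
  using normalizer_imp_subgroup subgroup_subset_normalizer by (auto simp: above_def dest: subgroup.subset)

lemma derived_mult_above:
  assumes "H \<in> above"
  shows "derived G (carrier G) <#> H \<in> above"
  using set_mult_normal_subgroup[OF aboveD(1)[OF assms] derived_self_is_normal]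
    commut_normal[OF aboveD(1)[OF assms] derived_self_is_normal]
    subset_set_mult(2)[OF normal_imp_subgroup[OF derived_self_is_normal] aboveD(1)[OF assms]]
    aboveD(3)[OF assms]
  by (auto simp: above_def)

lemma derived_mult_join:
  assumes "H \<in> above"
  shows "derived G (carrier G) <#> (H <#> B) = derived G (carrier G) <#> H <#> B"
  using assms aboveD(2) B.subset by (simp add: set_mult_assoc derived_in_carrier)

lemma derived_normalizer_above: "H \<in> above \<Longrightarrow> derived_normalizer G H \<in> above"
  using subgroup_derived_normalizer subset_derived_normalizer by (auto simp: above_def)

text \<open>B centralizes G modulo A, so G = BM makes every complement M normal, hence alone in its
  class, and puts G' inside M. For H in M this gives T(H) \<le> G'H \<le> M and T(HB) = T(H)B. Both
  T(H) and H then meet B in A, so joining with B multiplies both orders by |B : A|.\<close>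

lemma card_central_case:
  assumes M: "M \<in> complements" and H: "H \<in> above" "H \<subseteq> M" and C: "centralizer_mod = B"
  shows "card (derived_normalizer G (H <#> B)) * card H = card (derived_normalizer G H) * card (H <#> B)"
    and "inj_on (subgroup_class G) {M \<in> complements. H \<subseteq> M}"
proof -
  let ?D = "derived G (carrier G)"
  have comm: "b \<otimes> g \<otimes> inv b \<otimes> inv g \<in> A" if "b \<in> B" "g \<in> carrier G" for b g
    using C that by (auto simp: centralizer_mod_def)
  have normal: "K \<lhd> G" if K: "K \<in> complements" for K
  proof (rule normal_invI)
    show K': "subgroup K G" using K by (simp add: complements_def)
    interpret K: subgroup K G by fact
    fix g x assume g: "g \<in> carrier G" and x: "x \<in> K"
    obtain b m where bm: "b \<in> B" "m \<in> K" "g = b \<otimes> m" using complement_decompose[OF K g] .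
    define y where "y = m \<otimes> x \<otimes> inv m"
    have y: "y \<in> K" using bm x by (simp add: y_def)
    have "g \<otimes> x \<otimes> inv g = (b \<otimes> y \<otimes> inv b \<otimes> inv y) \<otimes> y"
      using bm x by (simp add: y_def m_assoc inv_mult_group)
    moreover have "b \<otimes> y \<otimes> inv b \<otimes> inv y \<in> K"
      using comm[OF bm(1)] y aboveD(3)[OF complements_above[OF K]] by auto
    ultimately show "g \<otimes> x \<otimes> inv g \<in> K" using y by simp
  qed
  show "inj_on (subgroup_class G) {M \<in> complements. H \<subseteq> M}"
  proof (rule inj_onI)
    fix K L assume KL: "K \<in> {M \<in> complements. H \<subseteq> M}" "L \<in> {M \<in> complements. H \<subseteq> M}"
      "subgroup_class G K = subgroup_class G L"
    then obtain g where "g \<in> carrier G" "L = g <# K #> inv g"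
      using subgroup_class_eq_iff[of K L] by (auto simp: complements_def)
    then show "K = L" using KL conj_normal[OF normal] by simp
  qed
  interpret M: normal M G using normal[OF M] .
  have AM: "A \<subseteq> M" using aboveD(3)[OF complements_above[OF M]] .
  have DM: "?D \<subseteq> M"
    unfolding derived_def
  proof (rule generate_subgroup_incl[OF _ M.subgroup_axioms], safe)
    fix g h assume gh: "g \<in> carrier G" "h \<in> carrier G"
    obtain b m where bm: "b \<in> B" "m \<in> M" "g = b \<otimes> m" using complement_decompose[OF M gh(1)] .
    define k where "k = m \<otimes> h \<otimes> inv m \<otimes> inv h"
    have e: "k = m \<otimes> (h \<otimes> inv m \<otimes> inv h)" using bm gh by (simp add: k_def m_assoc)
    have k: "k \<in> M" unfolding e using bm(2) gh(2) by (intro M.m_closed M.inv_op_closed2 M.m_inv_closed)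
    \<comment> \<open>The first factor is a conjugate of an element of the normal subgroup M; the
      second lies in A because B/A is central.\<close>
    have "g \<otimes> h \<otimes> inv g \<otimes> inv h = (b \<otimes> k \<otimes> inv b) \<otimes> (b \<otimes> h \<otimes> inv b \<otimes> inv h)"
      using bm(1,2) gh(2) by (simp add: bm(3) k_def m_assoc inv_mult_group)
    moreover have "b \<otimes> k \<otimes> inv b \<in> M" using bm(1) k by (intro M.inv_op_closed2) auto
    moreover have "b \<otimes> h \<otimes> inv b \<otimes> inv h \<in> M" using comm[OF bm(1) gh(2)] AM by blast
    ultimately show "g \<otimes> h \<otimes> inv g \<otimes> inv h \<in> M" by simp
  qed
  have DHM: "?D <#> H \<subseteq> M" using set_mult_subset[OF M.subgroup_axioms DM H(2)] .
  note HB = join_above[OF H(1)] and T = derived_normalizer_above[OF H(1)]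
  interpret NB: subgroup "normalizer G (H <#> B)" G using aboveD(1)[OF normalizer_above[OF HB]] .
  have BN: "B \<subseteq> normalizer G (H <#> B)"
    using join_supset(2)[OF H(1)] subgroup_subset_normalizer[OF aboveD(1)[OF HB]] by blast
  have "derived_normalizer G (H <#> B) = derived_normalizer G H <#> B"
  proof (intro equalityI subsetI)
    fix x assume x: "x \<in> derived_normalizer G (H <#> B)"
    then have "x \<in> ?D <#> H <#> B" unfolding derived_normalizer_def derived_mult_join[OF H(1)] by blast
    then obtain y b where yb: "y \<in> ?D <#> H" "b \<in> B" "x = y \<otimes> b" by (auto simp: mem_set_mult)
    have yM: "y \<in> M" using yb DHM by blast
    have "y = x \<otimes> inv b" using yb yM by (simp add: m_assoc)
    also have "\<dots> \<in> normalizer G (H <#> B)"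
      using x yb BN by (intro NB.m_closed NB.m_inv_closed) (auto simp: derived_normalizer_def)
    finally have "y \<in> normalizer G H" using mem_normalizer_join_iff[OF M H yM] by simp
    then have "y \<in> derived_normalizer G H" using yb by (simp add: derived_normalizer_def)
    then show "x \<in> derived_normalizer G H <#> B"
      using yb mem_set_mult by blast
  next
    fix x assume "x \<in> derived_normalizer G H <#> B"
    then obtain y b where yb: "y \<in> normalizer G H" "y \<in> ?D <#> H" "b \<in> B" "x = y \<otimes> b"
      by (auto simp: mem_set_mult derived_normalizer_def)
    have "x \<in> ?D <#> H <#> B" using yb mem_set_mult by blast
    moreover have "x \<in> normalizer G (H <#> B)"
      unfolding yb(4) using yb normalizer_subset_join[OF H(1)] BN by (intro NB.m_closed) auto
    ultimately show "x \<in> derived_normalizer G (H <#> B)"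
      by (simp add: derived_normalizer_def derived_mult_join[OF H(1)])
  qed
  moreover have "derived_normalizer G H \<subseteq> M"
    using DHM by (auto simp: derived_normalizer_def)
  ultimately have 1: "card (derived_normalizer G H) * card B = card (derived_normalizer G (H <#> B)) * card A"
    using card_join[OF T below_complement_Int[OF M T]] by simp
  have 2: "card H * card B = card (H <#> B) * card A"
    using card_join[OF H(1) below_complement_Int[OF M H]] .
  have "(card (derived_normalizer G (H <#> B)) * card H) * card A =
      card (derived_normalizer G H) * (card H * card B)"
    by (simp add: 1[symmetric])
  also have "\<dots> = (card (derived_normalizer G H) * card (H <#> B)) * card A"
    by (simp add: 2)
  finally show "card (derived_normalizer G (H <#> B)) * card H = card (derived_normalizer G H) * card (H <#> B)"
    using A.finite_imp_card_positive[OF fin] by simp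
qed

text \<open>Some commutator [b,g] with b in B lies outside A. It lies in G'A \<inter> B, which is
  normal between A and B and so must be B. Hence B \<le> G'H, and T(HB) is cut out of the same group
  G'H as T(H). With S = M \<inter> T(H) one gets T(HB) = BS and T(H) = N_B(H) S, both factors
  meeting S in A, so |T(HB)| |N_B(H)| = |T(H)| |B|.\<close>

lemma card_noncentral_case:
  assumes M: "M \<in> complements" and H: "H \<in> above" "H \<subseteq> M" and C: "centralizer_mod \<noteq> B"
  shows "card (derived_normalizer G (H <#> B)) * card H * card (normalizer G H \<inter> B)
    = card (derived_normalizer G H) * card (H <#> B) * card A"
proof -
  let ?D = "derived G (carrier G)"
  interpret M: subgroup M G using M by (simp add: complements_def)
  have DA: "?D <#> A \<lhd> G" using normal_set_mult[OF derived_self_is_normal normal_A] .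
  have A_above: "A \<in> above" using A.subgroup_axioms by (simp add: above_def)
  have "centralizer_mod \<subset> B" using C by (auto simp: centralizer_mod_def)
  then obtain b g where bg: "b \<in> B" "g \<in> carrier G" "b \<otimes> g \<otimes> inv b \<otimes> inv g \<notin> A"
    by (auto simp: centralizer_mod_def)
  have "b \<otimes> (g \<otimes> inv b \<otimes> inv g) \<in> B"
    using bg by (intro B.m_closed B.inv_op_closed2 B.m_inv_closed)
  then have "b \<otimes> g \<otimes> inv b \<otimes> inv g \<in> B" using bg by (simp add: m_assoc)
  moreover have "b \<otimes> g \<otimes> inv b \<otimes> inv g \<in> ?D <#> A"
    using mem_derived[of b g] subset_set_mult(1)[OF normal_imp_subgroup[OF derived_self_is_normal] A.subgroup_axioms]
      bg by auto
  ultimately have "(?D <#> A) \<inter> B \<noteq> A" using bg(3) by blast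
  moreover have "A \<subseteq> (?D <#> A) \<inter> B" using aboveD(3)[OF derived_mult_above[OF A_above]] less by blast
  ultimately have "B \<subseteq> ?D <#> A"
    using chief[OF normal_subgroup_intersect[OF DA normal_B]] by blast
  also have "?D <#> A \<subseteq> ?D <#> H" using aboveD(3)[OF H(1)] by (intro mono_set_mult) auto
  finally have BD: "B \<subseteq> ?D <#> H" .
  have DHB: "?D <#> (H <#> B) = ?D <#> H"
    unfolding derived_mult_join[OF H(1)] using join_eq_iff[OF derived_mult_above[OF H(1)]] BD by blast
  note HB = join_above[OF H(1)]
  let ?T = "derived_normalizer G H" and ?TB = "derived_normalizer G (H <#> B)" and ?N = "normalizer G H \<inter> B"
  \<comment> \<open>By \<open>mem_normalizer_join_iff\<close> this is also M \<inter> T(HB). So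
    modulo A it complements B in T(HB) and N_B(H) in T(H), which lets the two orders be
    compared.\<close>
  define S where "S = M \<inter> ?T"
  interpret N: subgroup "normalizer G H" G using aboveD(1)[OF normalizer_above[OF H(1)]] .
  interpret NB: subgroup "normalizer G (H <#> B)" G using aboveD(1)[OF normalizer_above[OF HB]] .
  interpret DH: subgroup "?D <#> H" G using aboveD(1)[OF derived_mult_above[OF H(1)]] .
  interpret T: subgroup ?T G using aboveD(1)[OF derived_normalizer_above[OF H(1)]] .
  interpret TB: subgroup ?TB G using aboveD(1)[OF derived_normalizer_above[OF HB]] .
  have T_eq: "?T = normalizer G H \<inter> (?D <#> H)" and TB_eq: "?TB = normalizer G (H <#> B) \<inter> (?D <#> H)"
    by (simp_all add: derived_normalizer_def DHB)
  have NNB: "normalizer G H \<subseteq> normalizer G (H <#> B)" using normalizer_subset_join[OF H(1)] .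
  have T_TB: "?T \<subseteq> ?TB" unfolding T_eq TB_eq using NNB by blast
  have B_NB: "B \<subseteq> normalizer G (H <#> B)"
    using join_supset(2)[OF H(1)] subgroup_subset_normalizer[OF aboveD(1)[OF HB]] by blast
  have B_TB: "B \<subseteq> ?TB" unfolding TB_eq using B_NB BD by blast
  have S_above: "S \<in> above"
    unfolding S_def above_def
    using subgroups_Inter_pair[OF M.subgroup_axioms T.subgroup_axioms]
      aboveD(3)[OF complements_above[OF M]] aboveD(3)[OF derived_normalizer_above[OF H(1)]] by blast
  have S_Int: "S \<inter> B = A" by (rule below_complement_Int[OF M S_above]) (simp add: S_def)
  have N_sub: "subgroup ?N G" using subgroups_Inter_pair[OF N.subgroup_axioms B.subgroup_axioms] .
  have N_Int: "?N \<inter> S = A"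
    using S_Int aboveD(3)[OF normalizer_above[OF H(1)]] by blast
  have dec: "\<exists>b\<in>B. \<exists>m\<in>S. x = b \<otimes> m" if x: "x \<in> ?TB" for x
  proof -
    have "x \<in> carrier G" using x by simp
    then obtain b m where bm: "b \<in> B" "m \<in> M" "x = b \<otimes> m" using complement_decompose[OF M] by blast
    have "m = inv b \<otimes> x" using bm by simp
    also have "\<dots> \<in> ?TB" using x bm(1) B_TB by (intro TB.m_closed TB.m_inv_closed) auto
    finally have "m \<in> S"
      using mem_normalizer_join_iff[OF M H bm(2)] bm(2) by (simp add: S_def T_eq TB_eq)
    then show ?thesis using bm by blast
  qed
  have "S <#> B = B <#> S" using commut_normal[OF aboveD(1)[OF S_above] normal_B] .
  also have "B <#> S = ?TB"
  proof (intro equalityI subsetI)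
    fix x assume "x \<in> ?TB"
    then show "x \<in> B <#> S" using dec unfolding mem_set_mult by blast
  qed (use set_mult_subset[OF TB.subgroup_axioms B_TB, of S] T_TB in \<open>auto simp: S_def\<close>)
  finally have 1: "card S * card B = card ?TB * card A"
    using card_join[OF S_above S_Int] by simp
  have "?N <#> S = ?T"
  proof (intro equalityI subsetI)
    fix x assume x: "x \<in> ?T"
    then obtain b m where bm: "b \<in> B" "m \<in> S" "x = b \<otimes> m" using dec T_TB by blast
    then have mT: "m \<in> ?T" by (simp add: S_def)
    have "b = x \<otimes> inv m" using bm(1) mT by (simp add: bm(3) m_assoc)
    also have "\<dots> \<in> ?T" using x mT by simp
    finally have "b \<in> ?N" using bm(1) by (simp add: T_eq)
    then show "x \<in> ?N <#> S" using bm unfolding mem_set_mult by blast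
  next
    have "?N \<subseteq> ?T" unfolding T_eq using BD by blast
    then show "x \<in> ?T" if "x \<in> ?N <#> S" for x
      using that set_mult_subset[OF T.subgroup_axioms, of ?N S] by (auto simp: S_def)
  qed
  then have 2: "card ?N * card S = card ?T * card A"
    using card_set_mult[OF N_sub aboveD(1)[OF S_above] fin] N_Int by simp
  have 3: "card H * card B = card (H <#> B) * card A"
    using card_join[OF H(1) below_complement_Int[OF M H]] .
  have pos: "card A > 0" using A.finite_imp_card_positive[OF fin] .
  have "(card ?TB * card H * card ?N) * card A = (card ?TB * card A) * card H * card ?N"
    by simp
  also have "\<dots> = (card ?N * card S) * (card H * card B)" by (simp flip: 1)
  also have "\<dots> = (card ?T * card (H <#> B) * card A) * card A" by (simp add: 2 3)
  finally show ?thesis using pos by simp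
qed

text \<open>If z in B normalizes M, its commutators with M lie in M \<inter> B = A, and those with B
  lie in A by commutativity of B/A. As G = BM, z is central modulo A.\<close>

lemma normalizer_complement_Int:
  assumes M: "M \<in> complements" and C: "centralizer_mod = A"
  shows "normalizer G M \<inter> B = A"
proof (intro equalityI subsetI)
  interpret M: subgroup M G using M by (simp add: complements_def)
  have Ma: "M \<in> above" using complements_above[OF M] .
  fix z assume z: "z \<in> normalizer G M \<inter> B"
  have zm: "z \<otimes> m \<otimes> inv z \<otimes> inv m \<in> A" if m: "m \<in> M" for m
  proof -
    have "z \<otimes> m \<otimes> inv z \<in> M"
      using z m mem_normalizer_finite[OF aboveD(4)[OF Ma] aboveD(2)[OF Ma]] by blast
    then have "z \<otimes> m \<otimes> inv z \<otimes> inv m \<in> M" using m by simp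
    moreover have "z \<otimes> (m \<otimes> inv z \<otimes> inv m) \<in> B"
      using z m by (intro B.m_closed B.inv_op_closed2 B.m_inv_closed) auto
    then have "z \<otimes> m \<otimes> inv z \<otimes> inv m \<in> B" using z m by (simp add: m_assoc)
    ultimately show ?thesis using M by (auto simp: complements_def)
  qed
  have "z \<otimes> g \<otimes> inv z \<otimes> inv g \<in> A" if g: "g \<in> carrier G" for g
  proof -
    obtain b m where bm: "b \<in> B" "m \<in> M" "g = b \<otimes> m" using complement_decompose[OF M g] .
    have "(z \<otimes> b \<otimes> inv z \<otimes> inv b) \<otimes> (b \<otimes> (z \<otimes> m \<otimes> inv z \<otimes> inv m) \<otimes> inv b) \<in> A"
      using z bm by (intro A.m_closed[OF commutator_mem A.inv_op_closed2] zm) auto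
    also have "(z \<otimes> b \<otimes> inv z \<otimes> inv b) \<otimes> (b \<otimes> (z \<otimes> m \<otimes> inv z \<otimes> inv m) \<otimes> inv b) =
      z \<otimes> g \<otimes> inv z \<otimes> inv g"
      using z bm by (simp add: m_assoc inv_mult_group)
    finally show ?thesis .
  qed
  then show "z \<in> A" using z C by (auto simp: centralizer_mod_def)
next
  fix z assume "z \<in> A"
  then show "z \<in> normalizer G M \<inter> B"
    using aboveD(3)[OF normalizer_above[OF complements_above[OF M]]] less by blast
qed

text \<open>Since G = BM and M normalizes itself, every conjugate of M is a conjugate by some b in
  B. If it contains H, then inv b H b lies in M and also in HB, hence in M \<inter> HB = H, so b
  normalizes H.\<close>

lemma conjugate_complements:
  assumes M: "M \<in> complements" and H: "H \<in> above" "H \<subseteq> M"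
  shows "{K \<in> {K \<in> complements. H \<subseteq> K}. subgroup_class G K = subgroup_class G M}
    = (\<lambda>b. b <# M #> inv b) ` (normalizer G H \<inter> B)" (is "?L = ?R")
proof (intro equalityI subsetI)
  interpret M: subgroup M G using M by (simp add: complements_def)
  note Ma = complements_above[OF M] and HB = join_above[OF H(1)]
  interpret N: subgroup "normalizer G H" G using aboveD(1)[OF normalizer_above[OF H(1)]] .
  interpret HB: subgroup "H <#> B" G using aboveD(1)[OF HB] .
  fix K assume K: "K \<in> ?L"
  then have "subgroup_class G M = subgroup_class G K" "subgroup K G" by (auto simp: complements_def)
  then obtain g where g: "g \<in> carrier G" "K = g <# M #> inv g"
    using subgroup_class_eq_iff[OF M.subgroup_axioms] by blast
  obtain b m where bm: "b \<in> B" "m \<in> M" "g = b \<otimes> m" using complement_decompose[OF M g(1)] .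
  have "m <# M #> inv m = M"
    using subgroup_subset_normalizer[OF M.subgroup_axioms] bm(2) mem_normalizer[OF M.subset] by blast
  then have K_eq: "K = b <# M #> inv b"
    using bm conj_conj[of m b M] M.subset by (simp add: g(2))
  have bH: "b \<in> H <#> B" using bm(1) join_supset(2)[OF H(1)] by blast
  have "inv b \<otimes> x \<otimes> inv (inv b) \<in> H" if x: "x \<in> H" for x
  proof -
    have "x \<in> b <# M #> inv b" using K x K_eq by blast
    then have "inv b \<otimes> x \<otimes> b \<in> M" using bm(1) M.subset by (simp add: mem_conj)
    moreover have "inv b \<otimes> x \<otimes> b \<in> H <#> B"
      using bH x join_supset(1)[OF H(1)] by (intro HB.m_closed HB.m_inv_closed) auto
    ultimately show ?thesis using modular_below[OF M H] bm(1) by auto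
  qed
  then have "inv b \<in> normalizer G H"
    using mem_normalizer_finite[OF aboveD(4)[OF H(1)] aboveD(2)[OF H(1)]] bm(1) by simp
  then have "inv (inv b) \<in> normalizer G H" by (rule N.m_inv_closed)
  then show "K \<in> ?R" using bm(1) K_eq by auto
next
  fix K assume "K \<in> ?R"
  then obtain b where b: "b \<in> normalizer G H" "b \<in> B" "K = b <# M #> inv b" by blast
  have bc: "b \<in> carrier G" using b by simp
  have "H = b <# H #> inv b" using b(1) mem_normalizer[OF aboveD(2)[OF H(1)]] by simp
  also have "\<dots> \<subseteq> K" unfolding b(3) using H(2) by (rule conj_mono)
  finally show "K \<in> ?L"
    using conj_complement[OF M bc] class_conj[OF complements_above[OF M] bc] b(3) by simp
qed

text \<open>Two elements of N_B(H) give the same conjugate of M exactly when they differ on the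
  right by an element of N_B(M), which is A here; the fibres are cosets of A.\<close>

lemma card_conjugate_complements:
  assumes M: "M \<in> complements" and H: "H \<in> above" "H \<subseteq> M" and C: "centralizer_mod = A"
  shows "card (normalizer G H \<inter> B) = card A * card ((\<lambda>b. b <# M #> inv b) ` (normalizer G H \<inter> B))"
proof (rule card_constant_fibers)
  interpret M: subgroup M G using M by (simp add: complements_def)
  interpret N: subgroup "normalizer G H" G using aboveD(1)[OF normalizer_above[OF H(1)]] .
  interpret NM: subgroup "normalizer G M" G
    using aboveD(1)[OF normalizer_above[OF complements_above[OF M]]] .
  show "finite (normalizer G H \<inter> B)" using finite_subset[OF B.subset fin] by simp
  fix K assume "K \<in> (\<lambda>b. b <# M #> inv b) ` (normalizer G H \<inter> B)"
  then obtain b where b: "b \<in> normalizer G H" "b \<in> B" "K = b <# M #> inv b" by blast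
  have AN: "A \<subseteq> normalizer G H" using aboveD(3)[OF normalizer_above[OF H(1)]] .
  have bij: "bij_betw (\<lambda>a. b \<otimes> a) A {c \<in> normalizer G H \<inter> B. c <# M #> inv c = K}"
  proof (rule bij_betw_imageI)
    show "inj_on (\<lambda>a. b \<otimes> a) A" using b by (intro inj_onI) auto
    show "(\<lambda>a. b \<otimes> a) ` A = {c \<in> normalizer G H \<inter> B. c <# M #> inv c = K}"
    proof (intro equalityI subsetI)
      fix c assume "c \<in> (\<lambda>a. b \<otimes> a) ` A"
      then obtain a where a: "a \<in> A" "c = b \<otimes> a" by blast
      have "a \<in> normalizer G M" using a normalizer_complement_Int[OF M C] by blast
      then have "a <# M #> inv a = M" using mem_normalizer[OF M.subset] by blast
      then have "c <# M #> inv c = K"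
        using conj_conj[of a b M] M.subset a b by simp
      moreover have "c \<in> normalizer G H" using a b AN by (auto intro: N.m_closed)
      moreover have "c \<in> B" using a b less by auto
      ultimately show "c \<in> {c \<in> normalizer G H \<inter> B. c <# M #> inv c = K}" by blast
    next
      fix c assume c: "c \<in> {c \<in> normalizer G H \<inter> B. c <# M #> inv c = K}"
      then have cc: "c \<in> B" "c \<in> carrier G" "b \<in> carrier G" using b by auto
      have "(inv b \<otimes> c) <# M #> inv (inv b \<otimes> c) = inv b <# (c <# M #> inv c) #> inv (inv b)"
        using conj_conj[of c "inv b" M] M.subset cc by simp
      also have "\<dots> = inv b <# (b <# M #> inv b) #> inv (inv b)" using c b by simp
      also have "\<dots> = M"
        using conj_conj[of b "inv b" M] conj_one[OF M.subset] M.subset cc by simp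
      finally have "inv b \<otimes> c \<in> normalizer G M"
        using cc by (simp add: mem_normalizer[OF M.subset])
      moreover have "inv b \<otimes> c \<in> B" using b cc by simp
      ultimately have "inv b \<otimes> c \<in> A" using normalizer_complement_Int[OF M C] by blast
      moreover have "c = b \<otimes> (inv b \<otimes> c)" using cc by simp
      ultimately show "c \<in> (\<lambda>a. b \<otimes> a) ` A" by blast
    qed
  qed
  show "card {c \<in> normalizer G H \<inter> B. c <# M #> inv c = K} = card A"
    using bij_betw_same_card[OF bij] by simp
qed

lemma card_complements:
  assumes H: "H \<in> above"
  shows "card {M \<in> complements. H \<subseteq> M} * card (derived_normalizer G (H <#> B)) * card H =
    card (subgroup_class G ` {M \<in> complements. H \<subseteq> M}) * card (derived_normalizer G H) * card (H <#> B)"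
proof (cases "{M \<in> complements. H \<subseteq> M} = {}")
  case False
  let ?C = "{M \<in> complements. H \<subseteq> M}"
  obtain M where M: "M \<in> complements" "H \<subseteq> M" using False by blast
  show ?thesis
  proof (cases "centralizer_mod = B")
    case True
    then show ?thesis
      using card_central_case[OF M(1) H M(2) True] by (simp add: card_image mult.assoc)
  next
    case noncentral: False
    then have C: "centralizer_mod = A" using centralizer_mod_cases by blast
    have pos: "card A > 0" using A.finite_imp_card_positive[OF fin] .
    have finC: "finite ?C"
      using finite_subgroups[OF fin] by (rule rev_finite_subset) (auto simp: complements_def)
    \<comment> \<open>This is the index |N_B(H) : A|. The division is exact by
      \<open>card_conjugate_complements\<close>, and the value is the same for every complement
      above H.\<close>
    define k where "k = card (normalizer G H \<inter> B) div card A"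
    have fiber: "card {K \<in> ?C. subgroup_class G K = c} = k" if c: "c \<in> subgroup_class G ` ?C" for c
    proof -
      obtain L where L: "L \<in> complements" "H \<subseteq> L" "c = subgroup_class G L" using c by blast
      show ?thesis
        unfolding k_def L(3) conjugate_complements[OF L(1) H L(2)]
          card_conjugate_complements[OF L(1) H L(2) C] using pos by simp
    qed
    have k: "card (normalizer G H \<inter> B) = card A * k"
      unfolding k_def using card_conjugate_complements[OF M(1) H M(2) C] pos by simp
    have c: "card ?C = k * card (subgroup_class G ` ?C)"
      using card_constant_fibers[OF finC] fiber by blast
    have "card (derived_normalizer G (H <#> B)) * card H * k * card A
      = card (derived_normalizer G H) * card (H <#> B) * card A"
      using card_noncentral_case[OF M(1) H M(2) noncentral] unfolding k by (simp only: ac_simps)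
    then have "card (derived_normalizer G (H <#> B)) * card H * k = card (derived_normalizer G H) * card (H <#> B)"
      using pos by simp
    then have "card (subgroup_class G ` ?C) * (card (derived_normalizer G (H <#> B)) * card H * k) =
        card (subgroup_class G ` ?C) * (card (derived_normalizer G H) * card (H <#> B))" by simp
    then show ?thesis unfolding c by (simp only: ac_simps)
  qed
next
  case True
  then show ?thesis by (simp only: True image_empty card.empty)
qed

lemma mu_lambda_above_step:
  assumes "mu_lambda_above G B"
  shows "mu_lambda_above G A"
  unfolding mu_lambda_above_def
proof (intro allI impI)
  fix H assume "subgroup H G \<and> A \<subseteq> H"
  then have H: "H \<in> above" by (simp add: above_def)
  show "moebius_subgroups G H (carrier G) * int (card H) =
      int (card (derived_normalizer G H)) * moebius_classes G H (carrier G)"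
  proof (cases "B \<subseteq> H")
    case True
    then show ?thesis using assms aboveD(1)[OF H] by (simp add: mu_lambda_above_def)
  next
    case False
    let ?m = "moebius_subgroups G (H <#> B) (carrier G)" and ?l = "moebius_classes G (H <#> B) (carrier G)"
    let ?c = "int (card {M \<in> complements. H \<subseteq> M})"
    let ?c' = "int (card (subgroup_class G ` {M \<in> complements. H \<subseteq> M}))"
    let ?T = "int (card (derived_normalizer G H))" and ?TB = "int (card (derived_normalizer G (H <#> B)))"
    let ?h = "int (card H)" and ?hB = "int (card (H <#> B))"
    have B: "?m * ?hB = ?TB * ?l"
      using assms aboveD(1)[OF join_above[OF H]] join_supset(2)[OF H] by (simp add: mu_lambda_above_def)
    have c: "?c * ?TB * ?h = ?c' * ?T * ?hB"
      using arg_cong[OF card_complements[OF H], of int] by simp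
    \<comment> \<open>The equation for H is multiplied by |HB|, so that the equation for HB and then
      the identity between the two counts can be substituted; the factor is cancelled at the
      end.\<close>
    have "(- ?m * ?c * ?h) * ?hB = - (?m * ?hB) * ?c * ?h" by simp
    also have "\<dots> = - ?l * (?c * ?TB * ?h)" by (simp add: B)
    also have "\<dots> = (?T * (- ?l * ?c')) * ?hB" by (simp add: c)
    finally have "(- ?m * ?c * ?h) * ?hB = (?T * (- ?l * ?c')) * ?hB" .
    moreover have "?hB \<noteq> 0"
      using subgroup.finite_imp_card_positive[OF aboveD(1)[OF join_above[OF H]] fin] by simp
    ultimately show ?thesis
      using moebius_subgroups_complements[OF H False] moebius_classes_complements[OF H False] by simp
  qed
qed

end

section \<open>Descent through a solvable normal subgroup\<close>

lemma (in group) derived_set_mult_normal: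
  assumes D: "subgroup D G" and A: "A \<lhd> G"
  shows "derived G (D <#> A) \<subseteq> derived G D <#> A"
proof
  interpret A: normal A G by fact
  have hom: "group_hom G (G Mod A) ((#>) A)"
    by (intro group_hom.intro group_hom_axioms.intro A.factorgroup_is_group A.r_coset_hom_Mod is_group)
  have s: "D \<subseteq> carrier G" "D <#> A \<subseteq> carrier G"
    using subgroup.subset[OF D] set_mult_closed A.subset by auto
  have DA: "D <#> A = A <#> D" using commut_normal[OF D A] .
  \<comment> \<open>D and DA have the same image in G/A. Homomorphisms carry derived subgroups to
    derived subgroups, so the derived subgroups of D and DA agree modulo A.\<close>
  have "(#>) A ` (A <#> D) = (#>) A ` D"
  proof (intro equalityI subsetI)
    fix y assume "y \<in> (#>) A ` (A <#> D)"
    then obtain a d where "a \<in> A" "d \<in> D" "y = A #> (a \<otimes> d)" by (auto simp: mem_set_mult)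
    moreover from this have "A #> (a \<otimes> d) = A #> d"
      using s coset_mult_assoc[OF A.subset, of a d] coset_join2[OF _ A.subgroup_axioms, of a] by auto
    ultimately show "y \<in> (#>) A ` D" by blast
  qed (use subset_set_mult(2)[OF A.subgroup_axioms D] in blast)
  then have "(#>) A ` derived G (D <#> A) = (#>) A ` derived G D"
    using group_hom.derived_img[OF hom] s DA by metis
  fix x assume x: "x \<in> derived G (D <#> A)"
  then have xc: "x \<in> carrier G" using derived_in_carrier s by blast
  obtain d where d: "d \<in> derived G D" "A #> x = A #> d"
    using x \<open>(#>) A ` derived G (D <#> A) = (#>) A ` derived G D\<close> by blast
  then have "x \<in> A #> d" using rcos_self[OF xc A.subgroup_axioms] by simp
  then have "x \<in> A <#> derived G D" using d(1) by (auto simp: r_coset_def mem_set_mult)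
  then show "x \<in> derived G D <#> A"
    using commut_normal[OF derived_is_subgroup[OF s(1)] A] by simp
qed

text \<open>If \<open>B = B'A\<close>, then \<open>B\<close> lies modulo \<open>A\<close> in every term of the derived series of \<open>N\<close>.\<close>

lemma (in group) perfect_mod_normal_subset_derived:
  assumes A: "A \<lhd> G" and N: "subgroup N G" and B: "B \<subseteq> N" "B \<subseteq> derived G B <#> A"
  shows "B \<subseteq> (derived G ^^ n) N <#> A"
proof (induction n)
  case 0
  show ?case using B(1) subset_set_mult(1)[OF N normal_imp_subgroup[OF A]] by simp
next
  case (Suc n)
  let ?D = "(derived G ^^ n) N"
  have D: "subgroup ?D G" using exp_of_derived_is_subgroup[OF N] .
  have "derived G B \<subseteq> derived G ?D <#> A"
    using mono_derived[OF Suc] derived_set_mult_normal[OF D A] by blast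
  then have "derived G B <#> A \<subseteq> derived G ?D <#> A <#> A"
    by (intro mono_set_mult) auto
  also have "\<dots> = derived G ?D <#> (A <#> A)"
    using normal_imp_subgroup[OF A] derived_in_carrier subgroup.subset[OF D]
    by (intro set_mult_assoc) (auto dest: subgroup.subset)
  also have "A <#> A = A"
    using set_mult_subset[OF normal_imp_subgroup[OF A], of A A]
      subset_set_mult(1)[of A A] normal_imp_subgroup[OF A] by auto
  finally show ?case using B(2) by simp
qed

text \<open>The induction runs from N down to A: enlarging A to B shrinks |N| - |A|, and
  \<open>mu_lambda_above_step\<close> returns from B to A.\<close>

lemma (in group) mu_lambda_above_normal_subgroup:
  assumes fin: "finite (carrier G)" and N: "N \<lhd> G" and n: "(derived G ^^ n) N = {\<one>}"
    and P: "mu_lambda_above G N" and A: "A \<lhd> G" "A \<subseteq> N"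
  shows "mu_lambda_above G A"
  using A
proof (induction "card N - card A" arbitrary: A rule: less_induct)
  case less
  interpret N: normal N G by fact
  interpret A: normal A G by fact
  have finN: "finite N" using finite_subset[OF N.subset fin] .
  show ?case
  proof (cases "A = N")
    case False
    then have "N \<lhd> G \<and> A \<subset> N \<and> N \<subseteq> N" using N less.prems by blast
    \<comment> \<open>A normal subgroup of G of least order among those strictly above A and inside
      N. Least order makes it minimal under inclusion, which is what \<open>chief\<close> asks
      for.\<close>
    then obtain B where B: "B \<lhd> G" "A \<subset> B" "B \<subseteq> N"
      and min: "\<And>Z. Z \<lhd> G \<and> A \<subset> Z \<and> Z \<subseteq> N \<Longrightarrow> card B \<le> card Z"
      using ex_has_least_nat[of "\<lambda>Z. Z \<lhd> G \<and> A \<subset> Z \<and> Z \<subseteq> N" N card] by blast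
    interpret B: normal B G by fact
    have finB: "finite B" using finite_subset[OF B(3) finN] .
    have chief: "Z = A \<or> Z = B" if Z: "Z \<lhd> G" "A \<subseteq> Z" "Z \<subseteq> B" for Z
    proof (rule disjCI)
      assume "Z \<noteq> B"
      then have "card Z < card B" using Z finB by (intro psubset_card_mono) auto
      then show "Z = A" using min[of Z] Z B(3) by (metis leD psubsetI subset_trans)
    qed
    \<comment> \<open>B'A is normal in G between A and B. If it were B, the lemma on the derived
      series would put B inside the last term times A, which is A. So it equals A, and B/A is
      abelian.\<close>
    let ?W = "derived G B <#> A"
    have W: "?W \<lhd> G" using normal_set_mult[OF derived_is_normal[OF B(1)] less.prems(1)] .
    have dB: "subgroup (derived G B) G" using derived_is_subgroup[OF B.subset] .
    have WB: "?W \<subseteq> B"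
      using set_mult_subset[OF B.subgroup_axioms derived_incl[OF subset_refl B.subgroup_axioms]] B(2) by blast
    have "?W \<noteq> B"
    proof
      assume "?W = B"
      then have "B \<subseteq> {\<one>} <#> A"
        using perfect_mod_normal_subset_derived[OF less.prems(1) N.subgroup_axioms B(3), of n] n by simp
      also have "\<dots> \<subseteq> A" using A.one_closed by (intro set_mult_subset[OF A.subgroup_axioms]) auto
      finally show False using B(2) by blast
    qed
    then have "?W = A"
      using chief[OF W subset_set_mult(2)[OF dB A.subgroup_axioms] WB] by blast
    then have dA: "derived G B \<subseteq> A"
      using subset_set_mult(1)[OF dB A.subgroup_axioms] by simp
    interpret abelian_chief_factor G A B
    proof (unfold_locales)
      show "finite (carrier G)" "A \<subset> B" using fin B by auto
      show "b \<otimes> c \<otimes> inv b \<otimes> inv c \<in> A" if "b \<in> B" "c \<in> B" for b c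
        using that dA unfolding derived_def by (blast intro: generate.incl)
    qed (use chief in \<open>auto intro: A.coset_eq B.coset_eq\<close>)
    have "card A < card B" "card B \<le> card N"
      using B finB finN by (auto intro: psubset_card_mono card_mono)
    then have "mu_lambda_above G B" using B by (intro less.hyps) auto
    then show ?thesis by (rule mu_lambda_above_step)
  qed (use P in simp)
qed

theorem theorem5:
  fixes G :: "('a, 'b) monoid_scheme" and N :: "'a set"
  assumes "group G" and "finite (carrier G)"
    and "N \<lhd> G" and "solvable (G\<lparr>carrier := N\<rparr>)"
    and "mu_lambda_property (G Mod N)"
  shows "mu_lambda_property G"
proof -
  interpret N: normal N G by fact
  let ?N = "G\<lparr>carrier := N\<rparr>"
  interpret S: group ?N using N.subgroup_imp_group[OF N.subgroup_axioms] .
  obtain n where n: "(derived ?N ^^ n) N = {\<one>\<^bsub>G\<^esub>}"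
    using iffD1[OF S.solvable_iff_trivial_derived_seq assms(4)] by auto
  \<comment> \<open>Solvability speaks of derived subgroups formed in \<open>?N\<close>, the descent
    of those formed in \<open>G\<close>. They coincide because every term of the series stays inside
    N.\<close>
  have "(derived ?N ^^ k) N = (derived G ^^ k) N \<and> (derived G ^^ k) N \<subseteq> N" for k
  proof (induction k)
    case (Suc k)
    then show ?case
      using N.derived_consistent[OF _ N.subgroup_axioms] N.derived_incl[OF _ N.subgroup_axioms] by simp
  qed simp
  then have "(derived G ^^ n) N = {\<one>\<^bsub>G\<^esub>}" using n by simp
  moreover have "mu_lambda_above G N"
    using N.mu_lambda_above_quotient[OF assms(2,5)] .
  ultimately have "mu_lambda_above G {\<one>\<^bsub>G\<^esub>}"
    using N.one_closed by (intro N.mu_lambda_above_normal_subgroup[OF assms(2,3) _ _ N.one_is_normal]) auto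
  then show ?thesis using N.mu_lambda_property_iff[OF assms(2)] by simp
qed

end
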